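(* If $t_1t_j=q^{-N}$ for some positive integer $N$ and $j=3$ or $4$, then $$\{R_0,\dots,R_N,U_1,\dots,U_N\},\qquad\{T_0,\dots,T_N,S_1,\dots,S_N\},$$ $$\{X_{-N},\dots,X_0,X_1,\dots,X_N\}\qquad\text{and}\qquad\{Y_{-N},\dots,Y_0,Y_1,\dots,Y_N\}$$ are Racah-orthogonal bases for $V_N$, that is, bases of $V_N$ whose distinct elements are pairwise orthogonal with respect to the bilinear form $\langle\cdot,\cdot\rangle_{\rm Racah}$.
   Context: Notation: $0<q<1$, $\mathbf t=(t_1,t_2,t_3,t_4)$ with each $t_i$ real; $(a;q)_k=\prod_{i=0}^{k-1}(1-aq^i)$, $(a_1,\dots,a_r;q)_k=\prod_j(a_j;q)_k$, and ${}_4\phi_3(a_1,a_2,a_3,a_4;b_1,b_2,b_3;q,q)=\sum_{k\ge 0}\frac{(a_1,a_2,a_3,a_4;q)_k}{(q,b_1,b_2,b_3;q)_k}q^k$ (all series used terminate because of the first parameter). $V_N$ is the $(2N+1)$-dimensional real vector space of Laurent polynomials spanned by $z^{-N},\dots,z^{N}$. $R_n=R_n(z;\mathbf t\,|\,q)={}_4\phi_3(q^{-n},t_1t_2t_3t_4q^{n-1},t_1z,t_1/z;\;t_1t_2,t_1t_3,t_1t_4;q,q)$. $S_0=0$; for $n\ge1$, $S_n=z(1-t_3/z)(1-t_4/z)\;{}_4\phi_3(q^{1-n},t_1t_2t_3t_4q^{n},t_1z,qt_1/z;\;qt_1t_2,qt_1t_3,qt_1t_4;q,q)$. $T_n={}_4\phi_3(q^{-n},t_1t_2t_3t_4q^{n-1},t_1z,qt_1/z;\;qt_1t_2,t_1t_3,t_1t_4;q,q)$.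 For $n\ge1$, $U_n=\frac1z(1-t_1z)(1-t_2z)\,R_{n-1}(z;qt_1,qt_2,t_3,t_4\,|\,q)$. With $c=(1-t_1t_2)(1-t_1t_3)(1-t_1t_4)$: $X_{-n}=c\,R_n-t_1(1-t_1t_2t_3t_4q^{n-1})S_n$ ($n>0$), $X_n=c\,R_n+t_1^2t_2(1-q^n)S_n$ ($n\ge0$), $Y_{-n}=q^{n-1}t_3t_4\,c\,R_n-t_1(1-t_1t_2t_3t_4q^{n-1})S_n$ ($n>0$), $Y_n=q^n c\,R_n+t_1(1-q^n)S_n$ ($n\ge0$). When $t_1t_j=q^{-N}$, the Racah bilinear form on $V_N$ is defined by $$\langle f,g\rangle_{\rm Racah}=\sum_{k=1}^N\frac{(qt_1^2,qt_1t_2;q)_{k-1}(t_1t_3,t_1t_4;q)_k}{(qt_1/t_2,q;q)_{k-1}(qt_1/t_3,qt_1/t_4;q)_k}\Big(\frac{q}{t_1t_2t_3t_4}\Big)^k(-t_1t_2)f(t_1q^k)g(t_1q^k)$$ $$+\sum_{k=0}^N\frac{(qt_1^2,qt_1t_2,t_1t_3,t_1t_4;q)_k}{(qt_1/t_2,qt_1/t_3,qt_1/t_4,q;q)_k}\Big(\frac{q}{t_1t_2t_3t_4}\Big)^kf(q^{-k}/t_1)g(q^{-k}/t_1).$$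
   Formalization: Added: no denominator in the series or the form vanishes; t1t2t3t4q^m≠1 (0≤m≤2N-2); for T,S: t3t4≠q; for X: t1t2(1-q^n)+1-t1t2t3t4q^{n-1}≠0, for Y: t3t4(1-q^n)+q(1-t1t2t3t4q^{n-1})≠0 (1≤n≤N). Otherwise undefined or not a basis. *)

theory Defs
  imports "HOL-Analysis.Analysis" "HOL-Library.Poly_Mapping"
begin

text \<open>
  Real Laurent polynomials in one variable are the finitely supported functions from \<open>int\<close> to
  \<open>real\<close> with convolution as multiplication: \<open>Poly_Mapping.lookup f k\<close> is the coefficient of
  the \<open>k\<close>-th power of the variable.
\<close>

type_synonym laurent = "int \<Rightarrow>\<^sub>0 real"

instantiation poly_mapping :: (comm_monoid_add, "{real_algebra_1, comm_ring_1}") real_algebra_1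
begin

definition scaleR_poly_mapping :: "real \<Rightarrow> ('a \<Rightarrow>\<^sub>0 'b) \<Rightarrow> ('a \<Rightarrow>\<^sub>0 'b)" where
  "scaleR_poly_mapping c f = Poly_Mapping.single 0 (of_real c) * f"

instance
proof
  fix a b :: real and x y :: "'a \<Rightarrow>\<^sub>0 'b"
  show "a *\<^sub>R (x + y) = a *\<^sub>R x + a *\<^sub>R y"
    by (simp add: scaleR_poly_mapping_def distrib_left)
  show "(a + b) *\<^sub>R x = a *\<^sub>R x + b *\<^sub>R x"
    by (simp add: scaleR_poly_mapping_def distrib_right single_add)
  show "a *\<^sub>R b *\<^sub>R x = (a * b) *\<^sub>R x"
    by (simp add: scaleR_poly_mapping_def mult_single flip: mult.assoc)
  show "1 *\<^sub>R x = x"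
    by (simp add: scaleR_poly_mapping_def)
  show "a *\<^sub>R x * y = a *\<^sub>R (x * y)"
    by (simp add: scaleR_poly_mapping_def mult.assoc)
  show "x * a *\<^sub>R y = a *\<^sub>R (x * y)"
    by (simp add: scaleR_poly_mapping_def mult.left_commute)
qed

end

lemma lookup_scaleR_laurent: "Poly_Mapping.lookup (c *\<^sub>R f) k = c * Poly_Mapping.lookup f k"
  for f :: laurent
  by (simp add: scaleR_poly_mapping_def map.rep_eq when_def flip: mult_map_scale_conv_mult)

definition zvar :: laurent where
  "zvar = Poly_Mapping.single 1 1"

definition zinv :: laurent where
  "zinv = Poly_Mapping.single (- 1) 1"

lemma zvar_zinv: "zvar * zinv = 1"
  by (simp add: zvar_def zinv_def mult_single)

definition laurent_eval :: "laurent \<Rightarrow> real \<Rightarrow> real" where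
  "laurent_eval f x = (\<Sum>k\<in>Poly_Mapping.keys f. Poly_Mapping.lookup f k * x powi k)"

definition laurent_space :: "nat \<Rightarrow> laurent set" where
  "laurent_space N = span ((\<lambda>k. Poly_Mapping.single k 1) ` {- int N..int N})"

text \<open>The base \<open>q\<close> comes first; \<open>a\<close> may be a real number or a Laurent polynomial.\<close>

definition qpoch :: "real \<Rightarrow> 'a \<Rightarrow> nat \<Rightarrow> 'a::{real_algebra_1, comm_ring_1}" where
  "qpoch q a k = (\<Prod>i<k. 1 - a * of_real (q ^ i))"

text \<open>
  \<open>Sum_any\<close> is the sum over the finite support. All series used below have a first parameter
  of the form \<open>q powi (- int n)\<close>, hence terminate (see \<open>phi43_terminating\<close>); the summands beyond
  the termination point are zero even if a lower parameter makes their denominator vanish.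
\<close>

definition phi43 ::
  "real \<Rightarrow> real \<Rightarrow> real \<Rightarrow> laurent \<Rightarrow> laurent \<Rightarrow> real \<Rightarrow> real \<Rightarrow> real \<Rightarrow> laurent" where
  "phi43 q a1 a2 a3 a4 b1 b2 b3 =
     Sum_any (\<lambda>k. (qpoch q a1 k * qpoch q a2 k /
                   (qpoch q q k * qpoch q b1 k * qpoch q b2 k * qpoch q b3 k) * q ^ k)
                  *\<^sub>R (qpoch q a3 k * qpoch q a4 k))"

lemma qpoch_neg_power_eq_0:
  fixes q :: real
  assumes "q \<noteq> 0" "n < k"
  shows "qpoch q (q powi (- int n)) k = 0"
  unfolding qpoch_def using assms
  by (intro prod_zero bexI [of _ n]) (auto simp: power_int_minus)

lemma phi43_terminating:
  assumes "q \<noteq> 0"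
  shows "phi43 q (q powi (- int n)) a2 a3 a4 b1 b2 b3 =
     (\<Sum>k\<le>n. (qpoch q (q powi (- int n)) k * qpoch q a2 k /
              (qpoch q q k * qpoch q b1 k * qpoch q b2 k * qpoch q b3 k) * q ^ k)
             *\<^sub>R (qpoch q a3 k * qpoch q a4 k))"
  unfolding phi43_def
proof (rule Sum_any.expand_superset, simp, rule subsetI, rule ccontr)
  fix k
  assume "k \<in> {k. (qpoch q (q powi (- int n)) k * qpoch q a2 k /
              (qpoch q q k * qpoch q b1 k * qpoch q b2 k * qpoch q b3 k) * q ^ k)
             *\<^sub>R (qpoch q a3 k * qpoch q a4 k) \<noteq> 0}" and "k \<notin> {..n}"
  then show False
    using qpoch_neg_power_eq_0 [OF assms, of n k] by simp
qed

definition aw_R :: "real \<Rightarrow> real \<Rightarrow> real \<Rightarrow> real \<Rightarrow> real \<Rightarrow> nat \<Rightarrow> laurent" where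
  "aw_R q t1 t2 t3 t4 n =
     phi43 q (q powi (- int n)) (t1 * t2 * t3 * t4 * q powi (int n - 1))
       (t1 *\<^sub>R zvar) (t1 *\<^sub>R zinv) (t1 * t2) (t1 * t3) (t1 * t4)"

definition aw_S :: "real \<Rightarrow> real \<Rightarrow> real \<Rightarrow> real \<Rightarrow> real \<Rightarrow> nat \<Rightarrow> laurent" where
  "aw_S q t1 t2 t3 t4 n =
     (if n = 0 then 0
      else zvar * (1 - t3 *\<^sub>R zinv) * (1 - t4 *\<^sub>R zinv) *
        phi43 q (q powi (1 - int n)) (t1 * t2 * t3 * t4 * q ^ n)
          (t1 *\<^sub>R zvar) ((q * t1) *\<^sub>R zinv) (q * t1 * t2) (q * t1 * t3) (q * t1 * t4))"

definition aw_T :: "real \<Rightarrow> real \<Rightarrow> real \<Rightarrow> real \<Rightarrow> real \<Rightarrow> nat \<Rightarrow> laurent" where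
  "aw_T q t1 t2 t3 t4 n =
     phi43 q (q powi (- int n)) (t1 * t2 * t3 * t4 * q powi (int n - 1))
       (t1 *\<^sub>R zvar) ((q * t1) *\<^sub>R zinv) (q * t1 * t2) (t1 * t3) (t1 * t4)"

text \<open>Only used for \<open>n \<ge> 1\<close>.\<close>

definition aw_U :: "real \<Rightarrow> real \<Rightarrow> real \<Rightarrow> real \<Rightarrow> real \<Rightarrow> nat \<Rightarrow> laurent" where
  "aw_U q t1 t2 t3 t4 n =
     zinv * (1 - t1 *\<^sub>R zvar) * (1 - t2 *\<^sub>R zvar) * aw_R q (q * t1) (q * t2) t3 t4 (n - 1)"

definition aw_c :: "real \<Rightarrow> real \<Rightarrow> real \<Rightarrow> real \<Rightarrow> real" where
  "aw_c t1 t2 t3 t4 = (1 - t1 * t2) * (1 - t1 * t3) * (1 - t1 * t4)"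

definition aw_X :: "real \<Rightarrow> real \<Rightarrow> real \<Rightarrow> real \<Rightarrow> real \<Rightarrow> int \<Rightarrow> laurent" where
  "aw_X q t1 t2 t3 t4 m =
     (let n = nat \<bar>m\<bar> in
      if m < 0 then
        aw_c t1 t2 t3 t4 *\<^sub>R aw_R q t1 t2 t3 t4 n
        - (t1 * (1 - t1 * t2 * t3 * t4 * q ^ (n - 1))) *\<^sub>R aw_S q t1 t2 t3 t4 n
      else
        aw_c t1 t2 t3 t4 *\<^sub>R aw_R q t1 t2 t3 t4 n
        + (t1\<^sup>2 * t2 * (1 - q ^ n)) *\<^sub>R aw_S q t1 t2 t3 t4 n)"

definition aw_Y :: "real \<Rightarrow> real \<Rightarrow> real \<Rightarrow> real \<Rightarrow> real \<Rightarrow> int \<Rightarrow> laurent" where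
  "aw_Y q t1 t2 t3 t4 m =
     (let n = nat \<bar>m\<bar> in
      if m < 0 then
        (q ^ (n - 1) * t3 * t4 * aw_c t1 t2 t3 t4) *\<^sub>R aw_R q t1 t2 t3 t4 n
        - (t1 * (1 - t1 * t2 * t3 * t4 * q ^ (n - 1))) *\<^sub>R aw_S q t1 t2 t3 t4 n
      else
        (q ^ n * aw_c t1 t2 t3 t4) *\<^sub>R aw_R q t1 t2 t3 t4 n
        + (t1 * (1 - q ^ n)) *\<^sub>R aw_S q t1 t2 t3 t4 n)"

definition racah_form ::
  "nat \<Rightarrow> real \<Rightarrow> real \<Rightarrow> real \<Rightarrow> real \<Rightarrow> real \<Rightarrow> laurent \<Rightarrow> laurent \<Rightarrow> real" where
  "racah_form N q t1 t2 t3 t4 f g =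
     (\<Sum>k=1..N.
        qpoch q (q * t1\<^sup>2) (k - 1) * qpoch q (q * t1 * t2) (k - 1) *
        qpoch q (t1 * t3) k * qpoch q (t1 * t4) k /
        (qpoch q (q * t1 / t2) (k - 1) * qpoch q q (k - 1) *
         qpoch q (q * t1 / t3) k * qpoch q (q * t1 / t4) k) *
        (q / (t1 * t2 * t3 * t4)) ^ k * (- (t1 * t2)) *
        laurent_eval f (t1 * q ^ k) * laurent_eval g (t1 * q ^ k))
     + (\<Sum>k=0..N.
        qpoch q (q * t1\<^sup>2) k * qpoch q (q * t1 * t2) k *
        qpoch q (t1 * t3) k * qpoch q (t1 * t4) k /
        (qpoch q (q * t1 / t2) k * qpoch q (q * t1 / t3) k *
         qpoch q (q * t1 / t4) k * qpoch q q k) *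
        (q / (t1 * t2 * t3 * t4)) ^ k *
        laurent_eval f (q powi (- int k) / t1) * laurent_eval g (q powi (- int k) / t1))"

definition racah_orthogonal_basis ::
  "nat \<Rightarrow> real \<Rightarrow> real \<Rightarrow> real \<Rightarrow> real \<Rightarrow> real \<Rightarrow> laurent set \<Rightarrow> bool" where
  "racah_orthogonal_basis N q t1 t2 t3 t4 B \<longleftrightarrow>
     independent B \<and> span B = laurent_space N \<and>
     pairwise (\<lambda>f g. racah_form N q t1 t2 t3 t4 f g = 0) B"

text \<open>
  No denominator vanishes in the series for \<open>R\<^sub>n\<close>, \<open>T\<^sub>n\<close> with \<open>n \<le> N\<close> and \<open>S\<^sub>n\<close>, \<open>U\<^sub>n\<close> with
  \<open>1 \<le> n \<le> N\<close> (first three conditions; \<open>N + 1\<close> because the lower parameter \<open>q t\<^sub>1 t\<^sub>2\<close> occurs in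
  \<open>T\<^sub>N\<close>), nor in the Racah form (the others; \<open>t\<^sub>1 \<noteq> 0\<close> is implied by \<open>t\<^sub>1 t\<^sub>j = q\<^sup>-\<^sup>N\<close>).
\<close>

definition racah_well_defined :: "nat \<Rightarrow> real \<Rightarrow> real \<Rightarrow> real \<Rightarrow> real \<Rightarrow> real \<Rightarrow> bool" where
  "racah_well_defined N q t1 t2 t3 t4 \<longleftrightarrow>
     qpoch q (t1 * t2) (N + 1) \<noteq> 0 \<and> qpoch q (t1 * t3) N \<noteq> 0 \<and> qpoch q (t1 * t4) N \<noteq> 0 \<and>
     t2 \<noteq> 0 \<and> t3 \<noteq> 0 \<and> t4 \<noteq> 0 \<and>
     qpoch q (q * t1 / t2) N \<noteq> 0 \<and> qpoch q (q * t1 / t3) N \<noteq> 0 \<and> qpoch q (q * t1 / t4) N \<noteq> 0"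

end

theory Submission
  imports Defs
begin

text \<open>
  The Racah form of \<open>f\<close> and \<open>g\<close> is a linear functional of \<open>f g\<close>, supported on nodes that are
  paired both by \<open>z \<mapsto> 1/z\<close> and, up to one node, by \<open>z \<mapsto> q/z\<close>. Adding the coefficients of paired
  nodes gives \<open>q\<close>-Racah weights, while multiplied by \<open>(1 - t1 z)(1 - t2 z)/z\<close>, respectively by
  \<open>z (1 - t3/z)(1 - t4/z)\<close>, paired coefficients become opposite. Hence the classical orthogonality
  of the \<open>q\<close>-Racah polynomials, for suitably shifted parameters, shows that \<open>R\<^sub>n\<close>, \<open>U\<^sub>n\<close>, \<open>S\<^sub>n\<close>
  and, if \<open>t3 t4 \<noteq> q\<close>, \<open>T\<^sub>n\<close> are orthogonal to \<open>V\<^sub>n\<^sub>-\<^sub>1\<close>, that \<open>R\<^sub>n\<close> is orthogonal to \<open>U\<^sub>n\<close>, and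
  that \<open>T\<^sub>n\<close> is orthogonal to \<open>S\<^sub>n\<close>. Modulo \<open>V\<^sub>n\<^sub>-\<^sub>1\<close> an element of \<open>V\<^sub>n\<close> is determined by its
  coefficients of \<open>z\<^sup>n\<close> and \<open>z\<^sup>-\<^sup>n\<close>. Comparing these, one reads off the ratios of
  \<open>\<langle>R\<^sub>n, R\<^sub>n\<rangle>\<close>, \<open>\<langle>R\<^sub>n, S\<^sub>n\<rangle>\<close> and \<open>\<langle>S\<^sub>n, S\<^sub>n\<rangle>\<close>, which give the orthogonality of \<open>X\<^sub>n\<close> and \<open>X\<^sub>-\<^sub>n\<close>
  and of \<open>Y\<^sub>n\<close> and \<open>Y\<^sub>-\<^sub>n\<close>; and one sees by induction that each family spans \<open>V\<^sub>N\<close>. Some weights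
  may vanish, so linear independence is obtained from the dimension of \<open>V\<^sub>N\<close>, not from the form.
\<close>

subsection \<open>Orthogonality of the \<open>q\<close>-Racah polynomials\<close>

lemma qpoch_0 [simp]: "qpoch q a 0 = 1"
  by (simp add: qpoch_def)

lemma qpoch_Suc: "qpoch q a (Suc k) = qpoch q a k * (1 - a * of_real (q ^ k))"
  by (simp add: qpoch_def)

lemma qpoch_Suc_shift:
  fixes a :: real
  shows "qpoch q a (Suc k) = (1 - a) * qpoch q (q * a) k"
  by (simp add: qpoch_def prod.lessThan_Suc_shift mult_ac del: prod.lessThan_Suc)

text \<open>Both sides are (a;q)_(k+1), once with the first and once with the last factor split off.
  This form shifts a parameter by q without division.\<close>

lemma qpoch_shift_mult:
  fixes a :: real
  shows "(1 - a) * qpoch q (q * a) k = qpoch q a k * (1 - a * q ^ k)"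
  using qpoch_Suc_shift [of q a k] qpoch_Suc [of q a k] by simp

lemma qpoch_real_eq_0_iff:
  fixes a :: real
  shows "qpoch q a k = 0 \<longleftrightarrow> (\<exists>i<k. a * q ^ i = 1)"
  by (auto simp: qpoch_def)

lemma qpoch_nonzero_mono:
  fixes a :: real
  assumes "qpoch q a n \<noteq> 0" "k \<le> n"
  shows "qpoch q a k \<noteq> 0"
  using assms by (auto simp: qpoch_real_eq_0_iff)

lemma qpoch_nonzero_shift:
  fixes a :: real
  assumes "qpoch q a n \<noteq> 0" "Suc k \<le> n"
  shows "qpoch q (q * a) k \<noteq> 0"
  using qpoch_nonzero_mono [OF assms] by (simp add: qpoch_Suc_shift)

lemma power_eq_1_iff_less_1:
  fixes q :: real
  assumes "0 < q" "q < 1"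
  shows "q ^ n = 1 \<longleftrightarrow> n = 0"
  using power_Suc_less_one [of q] assms by (cases n) (auto simp: less_imp_neq)

lemma qpoch_self_nonzero:
  fixes q :: real
  assumes "0 < q" "q < 1"
  shows "qpoch q q k \<noteq> 0"
  using power_eq_1_iff_less_1 [OF assms, of "Suc i" for i] by (auto simp: qpoch_real_eq_0_iff)

text \<open>The only vanishing factor of the infinite product has index n, out of range for k \<le>
  n.\<close>

lemma qpoch_inverse_power_nonzero:
  fixes q :: real
  assumes "0 < q" "q < 1" "k \<le> n"
  shows "qpoch q (1 / q ^ n) k \<noteq> 0"
proof
  assume "qpoch q (1 / q ^ n) k = 0"
  then obtain i where i: "i < k" "1 / q ^ n * q ^ i = 1"
    by (auto simp: qpoch_real_eq_0_iff)
  have "q ^ n = q ^ i * q ^ (n - i)"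
    using i assms by (simp flip: power_add)
  with i assms have "q ^ (n - i) = 1"
    by (auto simp: field_simps)
  with i assms power_eq_1_iff_less_1 [of q "n - i"] show False
    by simp
qed

text \<open>The factors with index i multiply to 1 + A q^(2i) - q^i (q^-k + A q^k), so this is a
  polynomial of degree j in the q-Racah variable q^-k + A q^k.\<close>

definition racah_e :: "real \<Rightarrow> real \<Rightarrow> nat \<Rightarrow> nat \<Rightarrow> real" where
  "racah_e q A j k = qpoch q (A * q ^ k) j * qpoch q (1 / q ^ k) j"

text \<open>The q-Racah polynomial of degree n on the grid k = 0, ..., N, with lower parameters B, C
  and q^-N; its second upper parameter is the one that makes the 4phi3 balanced.\<close>

definition racah_phi :: "real \<Rightarrow> real \<Rightarrow> real \<Rightarrow> real \<Rightarrow> nat \<Rightarrow> nat \<Rightarrow> nat \<Rightarrow> real" where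
  "racah_phi q A B C N n k =
     (\<Sum>i\<le>n. qpoch q (1 / q ^ n) i * qpoch q (B * C / (A * q ^ N) * q ^ n / q) i /
        (qpoch q q i * qpoch q B i * qpoch q C i * qpoch q (1 / q ^ N) i) * q ^ i
        * racah_e q A i k)"

text \<open>At \<open>k = N\<close> the factor \<open>1 - A q\<^sup>2\<^sup>N\<close> has been cancelled, since it may vanish.\<close>

definition racah_weight :: "real \<Rightarrow> real \<Rightarrow> real \<Rightarrow> real \<Rightarrow> nat \<Rightarrow> nat \<Rightarrow> real" where
  "racah_weight q A B C N k =
     (if k = 0 then 1
      else (if k = N then 1 / qpoch q (q * q ^ N * A) (N - 1)
            else (1 - A * (q ^ k)\<^sup>2) / qpoch q (q * q ^ N * A) k) *
        (qpoch q (q * A) (k - 1) * qpoch q B k * qpoch q C k * qpoch q (1 / q ^ N) k) /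
        (qpoch q q k * qpoch q (q * A / B) k * qpoch q (q * A / C) k) *
        (q * q ^ N * A / (B * C)) ^ k)"

text \<open>
  The boundary term of the summation by parts. By \<open>racah_bdry_shift\<close> it is, up to an elementary
  factor, the weight for the parameters multiplied by \<open>q\<close>.
\<close>

definition racah_bdry :: "real \<Rightarrow> real \<Rightarrow> real \<Rightarrow> real \<Rightarrow> nat \<Rightarrow> nat \<Rightarrow> real" where
  "racah_bdry q A B C N k =
     qpoch q (q * A) k * qpoch q B (Suc k) * qpoch q C (Suc k) * qpoch q (1 / q ^ N) (Suc k) /
     (qpoch q q k * qpoch q (q * A / B) k * qpoch q (q * A / C) k * qpoch q (q * q ^ N * A) k) *
     (q ^ N * A / (B * C)) ^ k"

section \<open>Shift and difference relations for the basis polynomials\<close>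

lemma racah_e_0 [simp]: "racah_e q A 0 k = 1"
  by (simp add: racah_e_def)

lemma racah_e_at_0: "racah_e q A (Suc j) 0 = 0"
  by (simp add: racah_e_def qpoch_Suc_shift)

lemma racah_e_Suc:
  "racah_e q A (Suc i) k = racah_e q A i k * ((1 - A * q ^ k * q ^ i) * (1 - q ^ i / q ^ k))"
  by (simp add: racah_e_def qpoch_Suc mult_ac)

lemma racah_e_shift:
  "(1 - A * q ^ k) * racah_e q (q * A) i k = racah_e q A i k * (1 - A * q ^ k * q ^ i)"
  using qpoch_shift_mult [of "A * q ^ k" q i] by (simp add: racah_e_def mult_ac)

lemma racah_e_shift':
  assumes "q \<noteq> 0"
  shows "(1 - 1 / q ^ Suc l) * racah_e q (q * A) i l
    = racah_e q A i (Suc l) * (1 - q ^ i / q ^ Suc l)"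
  using qpoch_shift_mult [of "1 / q ^ Suc l" q i] assms by (simp add: racah_e_def mult_ac)

text \<open>The forward difference lowers the degree and shifts A to q A: both values contain all
  factors of \<open>racah_e q (q * A) j k\<close>, and a rational identity in q^k and q^j
  remains.\<close>

lemma racah_e_diff:
  assumes "q \<noteq> 0"
  shows "racah_e q A (Suc j) (Suc k) - racah_e q A (Suc j) k
    = - (1 - q ^ Suc j) / q ^ Suc k * (1 - q * A * (q ^ k)\<^sup>2) * racah_e q (q * A) j k"
proof -
  define u v where "u = q ^ k" and "v = q ^ j"
  have "u \<noteq> 0"
    using assms by (simp add: u_def)
  have 1: "racah_e q A (Suc j) (Suc k)
    = (1 - A * q * u * v) * (1 - 1 / (q * u)) * racah_e q (q * A) j k"
    using assms qpoch_Suc [of q "A * q ^ Suc k" j] qpoch_Suc_shift [of q "1 / q ^ Suc k" j]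
    by (simp add: racah_e_def u_def v_def mult_ac)
  have 2: "racah_e q A (Suc j) k
    = (1 - A * u) * (1 - v / u) * racah_e q (q * A) j k"
    using assms qpoch_Suc [of q "1 / q ^ k" j] qpoch_Suc_shift [of q "A * q ^ k" j]
    by (simp add: racah_e_def u_def v_def mult_ac)
  have "(1 - A * q * u * v) * (1 - 1 / (q * u)) - (1 - A * u) * (1 - v / u)
    = - (1 - q * v) / (q * u) * (1 - q * A * u\<^sup>2)"
    using assms \<open>u \<noteq> 0\<close> by (simp add: field_simps power2_eq_square)
  then show ?thesis
    unfolding 1 2 by (simp add: u_def v_def flip: left_diff_distrib)
qed

text \<open>Here u = q^k, v = q^i and d = q^N. The left side is a difference of boundary terms with
  common factors removed; the right side separates the parts belonging to \<open>racah_e\<close> of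
  degree i and i + 1.\<close>

lemma raising_identity:
  fixes A B C d u v :: real
  assumes "A \<noteq> 0" "B \<noteq> 0" "C \<noteq> 0" "d \<noteq> 0" "u \<noteq> 0" "v \<noteq> 0"
  shows "(1 - A * u * v) * (1 - B * u) * (1 - C * u) * (1 - u / d) / u
     + (1 - v / u) * (1 - A * u / B) * (1 - A * u / C) * (1 - d * A * u) * (B * C / (d * A))
    = (1 - A * u\<^sup>2) / v * ((1 - B * v) * (1 - C * v) * (1 - v / d)
        - (1 - B * C / (d * A) * v) * ((1 - A * u * v) * (1 - v / u)))"
  using assms by (simp add: divide_simps) algebra

text \<open>The preceding identity at u = d, where its first summand vanishes, with the possibly
  vanishing factor 1 - A d^2 cancelled on both sides.\<close>

lemma raising_identity_end:
  fixes A B C d v :: real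
  assumes "A \<noteq> 0" "B \<noteq> 0" "C \<noteq> 0" "d \<noteq> 0" "v \<noteq> 0"
  shows "(1 - v / d) * (1 - A * d / B) * (1 - A * d / C) * (B * C / (d * A))
    = 1 / v * ((1 - B * v) * (1 - C * v) * (1 - v / d)
        - (1 - B * C / (d * A) * v) * ((1 - A * d * v) * (1 - v / d)))"
  using assms by (simp add: divide_simps) algebra

lemma sum_by_parts:
  fixes f g :: "nat \<Rightarrow> real"
  shows "(\<Sum>k\<le>n. (f k - (if k = 0 then 0 else f (k - 1))) * g k)
    = f n * g n + (\<Sum>k<n. f k * (g k - g (Suc k)))"
  by (induction n) (simp_all add: algebra_simps)

text \<open>The last condition stops at N - 1 factors: the next factor would be 1 - A q^(2N), which
  may vanish and is cancelled in the weight.\<close>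

locale racah_params =
  fixes q A B C :: real and N :: nat
  assumes q: "0 < q" "q < 1"
    and nonzero: "A \<noteq> 0" "B \<noteq> 0" "C \<noteq> 0"
    and upper: "qpoch q B N \<noteq> 0" "qpoch q C N \<noteq> 0"
    and lower: "qpoch q (q * A / B) N \<noteq> 0" "qpoch q (q * A / C) N \<noteq> 0"
      "qpoch q (q * q ^ N * A) (N - 1) \<noteq> 0"
begin

abbreviation "e \<equiv> racah_e q A"
abbreviation "e' \<equiv> racah_e q (q * A)"
abbreviation "w \<equiv> racah_weight q A B C N"
abbreviation "V \<equiv> racah_bdry q A B C N"
abbreviation "P \<equiv> B * C / (A * q ^ N)"

lemma const_nonzero: "(1 - B) * (1 - C) * (1 - 1 / q ^ N) \<noteq> 0" if "0 < N"
  using qpoch_nonzero_mono [OF upper(1), of "Suc 0"] qpoch_nonzero_mono [OF upper(2), of "Suc 0"]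
    qpoch_inverse_power_nonzero [OF q, of "Suc 0" N] that
  by (simp add: qpoch_Suc)

lemma V_N: "V N = 0"
  using q by (simp add: racah_bdry_def qpoch_Suc)

text \<open>The backward shift relation on a single basis polynomial. Boundary terms at k and k - 1
  are elementary multiples of one common factor, so the claim reduces to
  \<open>raising_identity\<close>, or to \<open>raising_identity_end\<close> when k = N.\<close>

lemma raising:
  assumes "Suc l \<le> N"
  shows "V (Suc l) * e' i (Suc l) - V l * e' i l
    = w (Suc l) / q ^ i * ((1 - B * q ^ i) * (1 - C * q ^ i) * (1 - q ^ i / q ^ N) * e i (Suc l)
        - (1 - P * q ^ i) * e (Suc i) (Suc l))"
proof -
  define u v d where "u = q ^ Suc l" and "v = q ^ i" and "d = q ^ N"
  have uvd: "u \<noteq> 0" "v \<noteq> 0" "d \<noteq> 0" and q0: "q \<noteq> 0"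
    using q by (auto simp: u_def v_def d_def)
  have ql: "q ^ l = u / q"
    using q0 by (simp add: u_def)
  have nz: "qpoch q q (Suc l) \<noteq> 0" "qpoch q (q * A / B) (Suc l) \<noteq> 0"
      "qpoch q (q * A / C) (Suc l) \<noteq> 0" "qpoch q (q * q ^ N * A) l \<noteq> 0"
    using qpoch_self_nonzero [OF q] qpoch_nonzero_mono lower assms
    by (auto intro!: qpoch_nonzero_mono [OF lower(3)] qpoch_nonzero_mono [OF lower(1)]
        qpoch_nonzero_mono [OF lower(2)])
  \<comment> \<open>For u = q^N this is the weight itself; otherwise the weight is G (1 - A u^2) /
    (1 - d A u).\<close>
  define G where "G = qpoch q (q * A) l * qpoch q B (Suc l) * qpoch q C (Suc l) *
      qpoch q (1 / q ^ N) (Suc l) /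
      (qpoch q q (Suc l) * qpoch q (q * A / B) (Suc l) * qpoch q (q * A / C) (Suc l)
        * qpoch q (q * q ^ N * A) l) * (q * q ^ N * A / (B * C)) ^ Suc l"
  have Vl: "V l = G * ((1 - u) * (1 - A * u / B) * (1 - A * u / C)) * (B * C / (d * A * u))"
    using nz nonzero uvd q0 unfolding racah_bdry_def G_def
    by (simp add: qpoch_Suc ql power_divide power_mult_distrib flip: d_def)
  have X: "V l * e' i l = - u * G * ((1 - v / u) * (1 - A * u / B) * (1 - A * u / C))
      * (B * C / (d * A * u)) * e i (Suc l)"
  proof -
    have "1 - u = - u * (1 - 1 / u)"
      using uvd by (simp add: field_simps)
    then have "V l * e' i l = - u * G * ((1 - A * u / B) * (1 - A * u / C))
      * (B * C / (d * A * u)) * ((1 - 1 / u) * e' i l)"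
      unfolding Vl by simp
    also have "(1 - 1 / u) * e' i l = e i (Suc l) * (1 - v / u)"
      using racah_e_shift' [OF q0, of l A i] by (simp add: u_def v_def)
    finally show ?thesis
      by (simp only: mult_ac)
  qed
  have e_Suc: "e (Suc i) (Suc l) = e i (Suc l) * ((1 - A * u * v) * (1 - v / u))"
    by (simp only: racah_e_Suc u_def v_def)
  show ?thesis
  proof (cases "Suc l = N")
    case True
    then have ud: "u = d"
      by (simp add: u_def d_def)
    have W: "w (Suc l) = G"
      using True by (simp add: racah_weight_def G_def flip: True)
    have Z: "V (Suc l) = 0"
      using V_N True by simp
    have "V (Suc l) * e' i (Suc l) - V l * e' i l = G * e i (Suc l) *
      ((1 - v / d) * (1 - A * d / B) * (1 - A * d / C) * (B * C / (d * A)))"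
      using uvd unfolding X Z by (simp add: ud mult_ac)
    also have "\<dots> = w (Suc l) / v * ((1 - B * v) * (1 - C * v) * (1 - v / d) * e i (Suc l)
        - (1 - P * v) * e (Suc i) (Suc l))"
    proof -
      have gen: "G * E * (1 / v * (X - Y * Z)) = G / v * (X * E - Y * (E * Z))" for E X Y Z
        by (simp add: right_diff_distrib mult_ac)
      have P: "P = B * C / (d * A)"
        by (simp add: d_def mult_ac)
      show ?thesis
        unfolding raising_identity_end [OF nonzero uvd(3,2)] W e_Suc gen P ud ..
    qed
    finally show ?thesis
      by (simp add: u_def v_def d_def)
  next
    case False
    with assms have "Suc l < N"
      by simp
    then have nz': "qpoch q (q * q ^ N * A) (Suc l) \<noteq> 0"
      by (intro qpoch_nonzero_mono [OF lower(3)]) auto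
    then have nz'': "1 - d * A * u \<noteq> 0"
      by (simp add: qpoch_Suc d_def u_def mult_ac)
    define H where "H = G / (1 - d * A * u)"
    have G_H: "G = H * (1 - d * A * u)"
      using nz'' by (simp add: H_def)
    have dA: "qpoch q (q * q ^ N * A) (Suc l) = qpoch q (q * q ^ N * A) l * (1 - d * A * u)"
      by (simp add: qpoch_Suc d_def u_def)
    have W: "w (Suc l) = H * (1 - A * u\<^sup>2)"
      using False unfolding racah_weight_def dA by (simp add: G_def H_def u_def mult_ac)
    have Vk: "V (Suc l) = H * ((1 - A * u) * (1 - B * u) * (1 - C * u) * (1 - u / d) / u)"
    proof -
      have p: "(q ^ N * A / (B * C)) ^ Suc l = (q * q ^ N * A / (B * C)) ^ Suc l / u"
        using q0 by (simp add: u_def power_divide power_mult_distrib)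
      have s: "qpoch q (q * A) (Suc l) = qpoch q (q * A) l * (1 - A * u)"
        "qpoch q B (Suc (Suc l)) = qpoch q B (Suc l) * (1 - B * u)"
        "qpoch q C (Suc (Suc l)) = qpoch q C (Suc l) * (1 - C * u)"
        "qpoch q (1 / q ^ N) (Suc (Suc l)) = qpoch q (1 / q ^ N) (Suc l) * (1 - u / d)"
        by (simp_all add: qpoch_Suc u_def d_def mult_ac)
      show ?thesis
        unfolding racah_bdry_def H_def G_def p s dA by (simp add: mult_ac)
    qed
    have Y: "V (Suc l) * e' i (Suc l)
      = H * ((1 - A * u * v) * (1 - B * u) * (1 - C * u) * (1 - u / d) / u) * e i (Suc l)"
    proof -
      have "V (Suc l) * e' i (Suc l)
        = H * ((1 - B * u) * (1 - C * u) * (1 - u / d) / u) * ((1 - A * u) * e' i (Suc l))"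
        unfolding Vk by simp
      also have "(1 - A * u) * e' i (Suc l) = e i (Suc l) * (1 - A * u * v)"
        using racah_e_shift [of A q "Suc l" i] by (simp only: u_def v_def)
      finally show ?thesis
        by (simp add: mult_ac)
    qed
    have "V (Suc l) * e' i (Suc l) - V l * e' i l = H * e i (Suc l) *
      ((1 - A * u * v) * (1 - B * u) * (1 - C * u) * (1 - u / d) / u
     + (1 - v / u) * (1 - A * u / B) * (1 - A * u / C) * (1 - d * A * u) * (B * C / (d * A)))"
    proof -
      have X': "V l * e' i l = - (H * e i (Suc l) * ((1 - v / u) * (1 - A * u / B) *
        (1 - A * u / C) * (1 - d * A * u) * (B * C / (d * A))))"
        using uvd unfolding X G_H by (simp add: mult_ac)
      show ?thesis
        unfolding X' Y by (simp only: distrib_left diff_minus_eq_add mult_ac)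
    qed
    also have "\<dots> = w (Suc l) / v * ((1 - B * v) * (1 - C * v) * (1 - v / d) * e i (Suc l)
        - (1 - P * v) * e (Suc i) (Suc l))"
    proof -
      have gen: "H * E * (K / v * (X - Y * Z)) = H * K / v * (X * E - Y * (E * Z))" for E K X Y Z
        by (simp add: right_diff_distrib mult_ac)
      have P: "P = B * C / (d * A)"
        by (simp add: d_def mult_ac)
      show ?thesis
        unfolding raising_identity [OF nonzero uvd(3,1,2)] W e_Suc gen P ..
    qed
    finally show ?thesis
      by (simp add: v_def d_def)
  qed
qed

lemma raising_0:
  "V 0 * e' i 0 = w 0 / q ^ i * ((1 - B * q ^ i) * (1 - C * q ^ i) * (1 - q ^ i / q ^ N) * e i 0
        - (1 - P * q ^ i) * e (Suc i) 0)"
  by (cases i) (simp_all add: racah_e_at_0 racah_bdry_def racah_weight_def qpoch_Suc)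

text \<open>\<open>raising\<close> is summed against the coefficients of the shifted polynomial of
  degree m. Collecting the contributions to each basis polynomial gives the coefficients of the
  polynomial of degree m + 1.\<close>

lemma raising_phi:
  assumes "m < N" and "k \<le> N"
  defines "\<phi>' \<equiv> racah_phi q (q * A) (q * B) (q * C) (N - 1) m"
  shows "V k * \<phi>' k - (if k = 0 then 0 else V (k - 1) * \<phi>' (k - 1))
    = (1 - B) * (1 - C) * (1 - 1 / q ^ N) * w k * racah_phi q A B C N (Suc m) k"
proof -
  define D where "D = 1 / q ^ N"
  define f where "f i = qpoch q (1 / q ^ m) i * qpoch q (q * P * q ^ m) i" for i
  define r where "r i = qpoch q q i * qpoch q B i * qpoch q C i * qpoch q D i" for i
  define c where "c = (1 - B) * (1 - C) * (1 - D)"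
  \<comment> \<open>Term i of the shifted series contributes \<open>\<alpha> i\<close> to
    \<open>e i\<close> and, with a minus sign, \<open>\<beta> i\<close> to
    \<open>e (Suc i)\<close>.\<close>
  define \<alpha> where "\<alpha> i = c * f i / r i" for i
  define \<beta> where "\<beta> i = c * (1 - P * q ^ i) * (1 - q ^ Suc i) * f i / r (Suc i)" for i
  define g where "g i = f i / (qpoch q q i * qpoch q (q * B) i * qpoch q (q * C) i *
     qpoch q (q * D) i) * q ^ i" for i
  have q0: "q \<noteq> 0"
    using q by simp
  have D': "1 / q ^ (N - 1) = q * D"
    using assms(1) q0 by (cases N) (auto simp: D_def)
  have r0: "r i \<noteq> 0" if "i \<le> N" for i
    using that qpoch_self_nonzero [OF q] qpoch_nonzero_mono [OF upper(1) that]
      qpoch_nonzero_mono [OF upper(2) that] qpoch_inverse_power_nonzero [OF q that]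
    by (auto simp: r_def D_def)
  have P': "q * B * (q * C) / (q * A * q ^ (N - 1)) * q ^ m / q = q * P * q ^ m"
    using assms(1) q0 by (cases N) (auto simp: field_simps)
  have \<phi>': "\<phi>' k = (\<Sum>i\<le>m. g i * e' i k)" for k
    unfolding \<phi>'_def racah_phi_def g_def f_def D' P' ..
  have g_r: "g i * r (Suc i) = c * (1 - q ^ Suc i) * f i * q ^ i" if "i \<le> m" for i
  proof -
    have "r (Suc i) \<noteq> 0"
      using that assms(1) by (intro r0) auto
    then show ?thesis
      by (simp add: g_def r_def c_def qpoch_Suc_shift [of q B] qpoch_Suc_shift [of q C]
        qpoch_Suc_shift [of q D] qpoch_Suc [of q q])
  qed
  have b: "g i / q ^ i * (1 - P * q ^ i) = \<beta> i" if "i \<le> m" for i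
  proof -
    have "r (Suc i) \<noteq> 0"
      using that assms(1) by (intro r0) auto
    with g_r [OF that] have "g i = c * (1 - q ^ Suc i) * f i * q ^ i / r (Suc i)"
      by (simp add: field_simps)
    then show ?thesis
      using q0 by (simp add: \<beta>_def)
  qed
  have a: "g i / q ^ i * ((1 - B * q ^ i) * (1 - C * q ^ i) * (1 - q ^ i / q ^ N)) = \<alpha> i"
    if "i \<le> m" for i
  proof -
    have 1: "r (Suc i) \<noteq> 0" "r i \<noteq> 0"
      using that assms(1) by (auto intro!: r0)
    define x y where "x = (1 - B * q ^ i) * (1 - C * q ^ i) * (1 - q ^ i / q ^ N)"
      and "y = 1 - q ^ Suc i"
    have 2: "r (Suc i) = r i * (y * x)"
      by (simp add: r_def qpoch_Suc D_def x_def y_def mult_ac)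
    have "y \<noteq> 0"
      using 1 2 by auto
    moreover have "g i * (r i * (y * x)) = c * y * f i * q ^ i"
      using g_r [OF that] unfolding 2 by (simp only: y_def)
    ultimately have "g i * r i * x = c * f i * q ^ i"
      by simp
    then show ?thesis
      using 1 q0 unfolding \<alpha>_def x_def [symmetric] by (simp add: divide_simps mult_ac)
  qed
  have step: "V k * e' i k - (if k = 0 then 0 else V (k - 1) * e' i (k - 1))
    = w k / q ^ i * ((1 - B * q ^ i) * (1 - C * q ^ i) * (1 - q ^ i / q ^ N) * e i k
        - (1 - P * q ^ i) * e (Suc i) k)" for i
  proof (cases k)
    case 0
    then show ?thesis using raising_0 [of i] by simp
  next
    case (Suc l)
    then show ?thesis using raising [of l i] assms(2) by simp
  qed
  have "V k * \<phi>' k - (if k = 0 then 0 else V (k - 1) * \<phi>' (k - 1))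
    = (\<Sum>i\<le>m. g i * (V k * e' i k - (if k = 0 then 0 else V (k - 1) * e' i (k - 1))))"
    unfolding \<phi>' by (simp add: sum_distrib_left sum_subtractf algebra_simps)
  also have "\<dots> = (\<Sum>i\<le>m. w k * (\<alpha> i * e i k - \<beta> i * e (Suc i) k))"
  proof (intro sum.cong refl)
    fix i assume "i \<in> {..m}"
    then have i: "i \<le> m" by simp
    have gen: "g i * (w k / q ^ i * (x * s - y * t)) = w k * (g i / q ^ i * x * s - g i / q ^ i * y * t)"
      for x y s t
      using q0 by (simp add: field_simps)
    show "g i * (V k * e' i k - (if k = 0 then 0 else V (k - 1) * e' i (k - 1)))
      = w k * (\<alpha> i * e i k - \<beta> i * e (Suc i) k)"
      unfolding step gen a [OF i] b [OF i] ..
  qed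
  also have "\<dots> = w k * ((\<Sum>i\<le>m. \<alpha> i * e i k) - (\<Sum>i\<le>m. \<beta> i * e (Suc i) k))"
    by (simp only: sum_subtractf sum_distrib_left [symmetric])
  \<comment> \<open>Since (q^-m;q)_(m+1) is zero, the sum may run one index further; splitting off i
    = 0 then aligns both sums on \<open>e (Suc i)\<close>.\<close>
  also have "(\<Sum>i\<le>m. \<alpha> i * e i k) = (\<Sum>i\<le>Suc m. \<alpha> i * e i k)"
  proof -
    have "\<alpha> (Suc m) = 0"
      using q0 by (simp add: \<alpha>_def f_def qpoch_Suc)
    then show ?thesis by simp
  qed
  also have "\<dots> = \<alpha> 0 * e 0 k + (\<Sum>i\<le>m. \<alpha> (Suc i) * e (Suc i) k)"
    by (rule sum.atMost_Suc_shift)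
  also have "w k * (\<alpha> 0 * e 0 k + (\<Sum>i\<le>m. \<alpha> (Suc i) * e (Suc i) k) - (\<Sum>i\<le>m. \<beta> i * e (Suc i) k))
    = w k * (\<alpha> 0 * e 0 k + (\<Sum>i\<le>m. (\<alpha> (Suc i) - \<beta> i) * e (Suc i) k))"
    by (simp add: sum_subtractf left_diff_distrib)
  also have "\<dots> = c * w k * racah_phi q A B C N (Suc m) k"
  proof -
    have 1: "\<alpha> (Suc i) - \<beta> i = c * (qpoch q (1 / q ^ Suc m) (Suc i) *
      qpoch q (P * q ^ Suc m / q) (Suc i) / r (Suc i) * q ^ Suc i)" for i
    proof -
      define v d where "v = q ^ i" and "d = q ^ m"
      have 2: "qpoch q (1 / q ^ Suc m) (Suc i) = (1 - 1 / (q * d)) * qpoch q (1 / q ^ m) i"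
        "qpoch q (P * q ^ Suc m / q) (Suc i) = (1 - P * d) * qpoch q (q * P * q ^ m) i"
        using q0 by (simp_all add: qpoch_Suc_shift d_def mult_ac)
      have 3: "f (Suc i) = f i * ((1 - v / d) * (1 - q * P * d * v))"
        by (simp add: f_def qpoch_Suc v_def d_def mult_ac)
      \<comment> \<open>This identity merges two neighbouring coefficients into one. It is proved
        for a generic p, so that \<open>P\<close> is not expanded.\<close>
      have 4: "(1 - v / d) * (1 - q * P * d * v) - (1 - P * v) * (1 - q * v)
        = (1 - 1 / (q * d)) * (1 - P * d) * (q * v)"
      proof -
        have "d \<noteq> 0" using q0 by (simp add: d_def)
        have "(1 - v / d) * (1 - q * p * d * v) - (1 - p * v) * (1 - q * v)
          = (1 - 1 / (q * d)) * (1 - p * d) * (q * v)" for p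
          using q0 \<open>d \<noteq> 0\<close> by (simp add: field_simps)
        then show ?thesis .
      qed
      have "\<alpha> (Suc i) - \<beta> i = c * f i / r (Suc i) *
         ((1 - v / d) * (1 - q * P * d * v) - (1 - P * v) * (1 - q * v))"
        unfolding \<alpha>_def \<beta>_def 3
        by (simp add: v_def diff_divide_distrib [symmetric] right_diff_distrib [symmetric] mult_ac)
      then show ?thesis
        unfolding 4 2 by (simp add: f_def v_def)
    qed
    have 0: "\<alpha> 0 = c"
      by (simp add: \<alpha>_def f_def r_def)
    show ?thesis
      unfolding racah_phi_def sum.atMost_Suc_shift D_def [symmetric] 1 0
      by (simp add: r_def sum_distrib_left distrib_left mult_ac)
  qed
  finally show ?thesis
    by (simp only: c_def D_def)
qed

text \<open>Summation by parts; the end term disappears because \<open>V N\<close> is zero.\<close>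

lemma sum_raising:
  assumes "m < N"
  shows "(1 - B) * (1 - C) * (1 - 1 / q ^ N) * (\<Sum>k\<le>N. w k * racah_phi q A B C N (Suc m) k * g k)
    = (\<Sum>k<N. V k * racah_phi q (q * A) (q * B) (q * C) (N - 1) m k * (g k - g (Suc k)))"
proof -
  have "(1 - B) * (1 - C) * (1 - 1 / q ^ N) * (\<Sum>k\<le>N. w k * racah_phi q A B C N (Suc m) k * g k)
    = (\<Sum>k\<le>N. (1 - B) * (1 - C) * (1 - 1 / q ^ N) * w k * racah_phi q A B C N (Suc m) k * g k)"
    by (simp only: sum_distrib_left mult.assoc)
  also have "\<dots> = (\<Sum>k\<le>N. (V k * racah_phi q (q * A) (q * B) (q * C) (N - 1) m k -
    (if k = 0 then 0 else V (k - 1) * racah_phi q (q * A) (q * B) (q * C) (N - 1) m (k - 1))) * g k)"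
    by (intro sum.cong refl) (simp only: raising_phi [OF assms] atMost_iff)
  also have "\<dots> = (\<Sum>k<N. V k * racah_phi q (q * A) (q * B) (q * C) (N - 1) m k * (g k - g (Suc k)))"
    using sum_by_parts [of "\<lambda>k. V k * racah_phi q (q * A) (q * B) (q * C) (N - 1) m k" g N]
    by (simp add: V_N)
  finally show ?thesis .
qed

lemma racah_bdry_shift:
  assumes "N = Suc M" and "k \<le> M"
  shows "V k * (1 - q * A * (q ^ k)\<^sup>2) / q ^ k
    = (1 - q * A) * ((1 - B) * (1 - C) * (1 - 1 / q ^ N)) *
        racah_weight q (q * A) (q * B) (q * C) M k"
proof (cases k)
  case 0
  then show ?thesis
    by (simp add: racah_bdry_def racah_weight_def qpoch_Suc)
next
  case (Suc l)
  have q0: "q \<noteq> 0"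
    using q by simp
  have p: "(q * q ^ N * A / (q * B * (q * C))) ^ k = (q ^ N * A / (B * C)) ^ k / q ^ k"
    unfolding power_divide [symmetric] using q0 by (simp add: mult_ac)
  have s: "q * (q * A) / (q * B) = q * A / B" "q * (q * A) / (q * C) = q * A / C"
    "q * q ^ M * (q * A) = q * q ^ N * A" "1 / q ^ M = q * (1 / q ^ N)"
    using q0 assms(1) by simp_all
  have t: "qpoch q (q * A) k = (1 - q * A) * qpoch q (q * (q * A)) l"
    "qpoch q B (Suc k) = (1 - B) * qpoch q (q * B) k"
    "qpoch q C (Suc k) = (1 - C) * qpoch q (q * C) k"
    "qpoch q (1 / q ^ N) (Suc k) = (1 - 1 / q ^ N) * qpoch q (q * (1 / q ^ N)) k"
    by (simp_all only: Suc qpoch_Suc_shift)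
  \<comment> \<open>At k = M the two branches of the shifted weight agree: M = N - 1, so by
    \<open>lower(3)\<close> the cancelled factor is nonzero here.\<close>
  have z: "(if k = M then 1 / qpoch q (q * q ^ N * A) (M - 1)
      else (1 - q * A * (q ^ k)\<^sup>2) / qpoch q (q * q ^ N * A) k)
    = (1 - q * A * (q ^ k)\<^sup>2) / qpoch q (q * q ^ N * A) k"
  proof (cases "k = M")
    case True
    have "qpoch q (q * q ^ N * A) k = qpoch q (q * q ^ N * A) l * (1 - q * A * (q ^ k)\<^sup>2)"
    proof -
      have "M = Suc l"
        using True Suc by simp
      then show ?thesis
        unfolding assms(1) Suc qpoch_Suc by (simp add: power2_eq_square mult_ac)
    qed
    moreover have "qpoch q (q * q ^ N * A) k \<noteq> 0"
      using lower(3) True assms(1) by simp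
    moreover have "M - 1 = l"
      using True Suc by simp
    ultimately show ?thesis
      using True by simp
  qed simp
  have "k \<noteq> 0" "k - 1 = l"
    using Suc by simp_all
  then show ?thesis
    unfolding racah_bdry_def racah_weight_def p s z t by (simp add: mult_ac)
qed

end

lemma racah_params_shift:
  assumes "racah_params q A B C (Suc M)"
  shows "racah_params q (q * A) (q * B) (q * C) M"
proof -
  interpret racah_params q A B C "Suc M" by fact
  have s: "q * (q * A) / (q * B) = q * A / B" "q * (q * A) / (q * C) = q * A / C"
    "q * q ^ M * (q * A) = q * q ^ Suc M * A"
    using q by simp_all
  show ?thesis
    unfolding racah_params_def s
    using q nonzero qpoch_nonzero_shift [OF upper(1), of M] qpoch_nonzero_shift [OF upper(2), of M]
      qpoch_nonzero_mono [OF lower(1), of M] qpoch_nonzero_mono [OF lower(2), of M]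
      qpoch_nonzero_mono [OF lower(3), of "M - 1"]
    by auto
qed

text \<open>
  Summation by parts moves the difference operator from \<open>racah_phi\<close> to \<open>racah_e\<close>; it lowers both
  degrees and shifts all parameters by \<open>q\<close>.
\<close>

lemma racah_orthogonality:
  assumes "racah_params q A B C N" and "j < n" and "n \<le> N"
  shows "(\<Sum>k\<le>N. racah_weight q A B C N k * racah_phi q A B C N n k * racah_e q A j k) = 0"
  using assms
proof (induction j arbitrary: A B C N n)
  case (Suc j)
  interpret racah_params q A B C N by fact
  obtain m M where m: "n = Suc m" and M: "N = Suc M"
    using Suc.prems by (cases n; cases N) auto
  define c where "c = (1 - B) * (1 - C) * (1 - 1 / q ^ N)"
  have c: "c \<noteq> 0"
    unfolding c_def using M by (intro const_nonzero) simp
  let ?\<phi> = "racah_phi q (q * A) (q * B) (q * C) M m"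
  have "c * (\<Sum>k\<le>N. w k * racah_phi q A B C N n k * e (Suc j) k)
    = (\<Sum>k\<le>M. V k * ?\<phi> k * (e (Suc j) k - e (Suc j) (Suc k)))"
    using sum_raising [of m "e (Suc j)"] Suc.prems(3)
    unfolding c_def m M lessThan_Suc_atMost by simp
  \<comment> \<open>The difference of \<open>e (Suc j)\<close> supplies exactly the factor 1 - q A
    q^(2k) that turns \<open>V\<close> into the shifted weight.\<close>
  also have "\<dots> = (\<Sum>k\<le>M. (1 - q * A) * c * (1 - q ^ Suc j) / q *
      (racah_weight q (q * A) (q * B) (q * C) M k * ?\<phi> k * e' j k))"
  proof (intro sum.cong refl)
    fix k assume "k \<in> {..M}"
    then have 1: "V k * (1 - q * A * (q ^ k)\<^sup>2) / q ^ k
      = (1 - q * A) * c * racah_weight q (q * A) (q * B) (q * C) M k"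
      unfolding c_def by (intro racah_bdry_shift M) simp
    have 2: "e (Suc j) k - e (Suc j) (Suc k)
      = (1 - q ^ Suc j) / q ^ Suc k * (1 - q * A * (q ^ k)\<^sup>2) * e' j k"
    proof -
      have "e (Suc j) k - e (Suc j) (Suc k) = - (e (Suc j) (Suc k) - e (Suc j) k)"
        by simp
      also have "\<dots> = (1 - q ^ Suc j) / q ^ Suc k * (1 - q * A * (q ^ k)\<^sup>2) * e' j k"
        using q by (subst racah_e_diff) (simp_all add: minus_divide_left minus_mult_left del: mult_minus_left)
      finally show ?thesis .
    qed
    have "V k * ?\<phi> k * (e (Suc j) k - e (Suc j) (Suc k))
      = (V k * (1 - q * A * (q ^ k)\<^sup>2) / q ^ k) * ((1 - q ^ Suc j) / q) * ?\<phi> k * e' j k"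
      unfolding 2 by (simp add: mult_ac)
    then show "V k * ?\<phi> k * (e (Suc j) k - e (Suc j) (Suc k)) = (1 - q * A) * c * (1 - q ^ Suc j) / q *
      (racah_weight q (q * A) (q * B) (q * C) M k * ?\<phi> k * e' j k)"
      unfolding 1 by simp
  qed
  also have "\<dots> = 0"
    unfolding sum_distrib_left [symmetric]
    using Suc.IH [OF racah_params_shift, of A B C M m] Suc.prems m M by simp
  finally show ?case
    using c by simp
next
  case 0
  interpret racah_params q A B C N by fact
  obtain m M where m: "n = Suc m" and M: "N = Suc M"
    using 0 by (cases n; cases N) auto
  define c where "c = (1 - B) * (1 - C) * (1 - 1 / q ^ N)"
  have c: "c \<noteq> 0"
    unfolding c_def using M by (intro const_nonzero) simp
  \<comment> \<open>\<open>e 0\<close> is constant, so every difference on the right of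
    \<open>sum_raising\<close> is zero.\<close>
  have "c * (\<Sum>k\<le>N. w k * racah_phi q A B C N n k * e 0 k) = 0"
    using sum_raising [of m "e 0"] 0(3) unfolding c_def m by simp
  then show ?case
    using c by simp
qed

subsection \<open>Laurent polynomials\<close>

lemma mem_laurent_space:
  "f \<in> laurent_space n \<longleftrightarrow> (\<forall>k. int n < \<bar>k\<bar> \<longrightarrow> Poly_Mapping.lookup f k = 0)"
proof
  assume "f \<in> laurent_space n"
  then show "\<forall>k. int n < \<bar>k\<bar> \<longrightarrow> Poly_Mapping.lookup f k = 0"
    unfolding laurent_space_def
    by (induction rule: span_induct_alt)
      (auto simp: lookup_add lookup_scaleR_laurent lookup_single when_def split: if_splits)
next
  assume *: "\<forall>k. int n < \<bar>k\<bar> \<longrightarrow> Poly_Mapping.lookup f k = 0"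
  have "f = (\<Sum>k\<in>{- int n..int n}. Poly_Mapping.lookup f k *\<^sub>R Poly_Mapping.single k 1)"
  proof (rule poly_mapping_eqI)
    fix k
    show "Poly_Mapping.lookup f k = Poly_Mapping.lookup
        (\<Sum>k\<in>{- int n..int n}. Poly_Mapping.lookup f k *\<^sub>R Poly_Mapping.single k 1) k"
      using * by (cases "k \<in> {- int n..int n}")
        (auto simp: lookup_sum lookup_scaleR_laurent lookup_single when_def sum.delta'
          if_distrib [of "(*) _"] cong: if_cong)
  qed
  also have "\<dots> \<in> laurent_space n"
    unfolding laurent_space_def by (intro span_sum span_scale span_base) auto
  finally show "f \<in> laurent_space n" .
qed

lemma subspace_laurent_space: "subspace (laurent_space n)"
  by (simp add: laurent_space_def)

lemma dim_laurent_space: "real_vector.dim (laurent_space n) = 2 * n + 1"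
proof -
  let ?m = "\<lambda>k. Poly_Mapping.single k 1 :: laurent"
  have inj: "inj ?m"
  proof (rule injI)
    fix i j assume "?m i = ?m j"
    then have "Poly_Mapping.lookup (?m i) i = Poly_Mapping.lookup (?m j) i"
      by simp
    then show "i = j"
      by (simp add: lookup_single when_def split: if_splits)
  qed
  have "independent (?m ` {- int n..int n})"
  proof (rule independent_if_scalars_zero)
    fix u f
    assume 0: "(\<Sum>x\<in>?m ` {- int n..int n}. u x *\<^sub>R x) = 0"
      and "f \<in> ?m ` {- int n..int n}"
    then obtain k where k: "k \<in> {- int n..int n}" "f = ?m k"
      by auto
    have "0 = Poly_Mapping.lookup (\<Sum>j\<in>{- int n..int n}. u (?m j) *\<^sub>R ?m j) k"
      using 0 by (simp add: sum.reindex inj_on_subset [OF inj])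
    also have "\<dots> = u (?m k)"
      using k by (simp add: lookup_sum lookup_scaleR_laurent lookup_single when_def
          if_distrib [of "(*) _"] cong: if_cong)
    finally show "u f = 0"
      using k by simp
  qed simp
  then have "real_vector.dim (laurent_space n) = card (?m ` {- int n..int n})"
    unfolding laurent_space_def by (rule real_vector.dim_span_eq_card_independent)
  then show ?thesis
    by (simp add: card_image inj_on_subset [OF inj])
qed

lemma laurent_space_mono: "m \<le> n \<Longrightarrow> laurent_space m \<subseteq> laurent_space n"
  by (auto simp: mem_laurent_space)

lemma laurent_space_Suc:
  assumes "f \<in> laurent_space (Suc n)"
    and "Poly_Mapping.lookup f (int (Suc n)) = 0" and "Poly_Mapping.lookup f (- int (Suc n)) = 0"
  shows "f \<in> laurent_space n"
  unfolding mem_laurent_space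
proof (intro allI impI)
  fix k :: int assume "int n < \<bar>k\<bar>"
  then consider "k = int (Suc n)" | "k = - int (Suc n)" | "int (Suc n) < \<bar>k\<bar>"
    by linarith
  then show "Poly_Mapping.lookup f k = 0"
    using assms by cases (auto simp: mem_laurent_space)
qed

lemma laurent_expansion:
  fixes f :: laurent
  shows "f = (\<Sum>k\<in>Poly_Mapping.keys f. Poly_Mapping.single k (Poly_Mapping.lookup f k))"
proof (rule poly_mapping_eqI)
  fix j
  show "Poly_Mapping.lookup f j = Poly_Mapping.lookup
      (\<Sum>k\<in>Poly_Mapping.keys f. Poly_Mapping.single k (Poly_Mapping.lookup f k)) j"
    by (simp add: lookup_sum lookup_single when_def in_keys_iff)
qed

lemma lookup_single_mult:
  fixes f :: laurent
  shows "Poly_Mapping.lookup (Poly_Mapping.single i c * f) k = c * Poly_Mapping.lookup f (k - i)"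
proof -
  have "Poly_Mapping.single i c * f = (\<Sum>j\<in>Poly_Mapping.keys f.
      Poly_Mapping.single (i + j) (c * Poly_Mapping.lookup f j))"
    by (subst laurent_expansion [of f]) (simp add: sum_distrib_left mult_single)
  also have "Poly_Mapping.lookup \<dots> k = (\<Sum>j\<in>Poly_Mapping.keys f.
      if j = k - i then c * Poly_Mapping.lookup f j else 0)"
    unfolding lookup_sum by (intro sum.cong refl) (auto simp: lookup_single when_def)
  also have "\<dots> = c * Poly_Mapping.lookup f (k - i)"
    by (simp add: in_keys_iff)
  finally show ?thesis .
qed

lemma lookup_zvar_mult: "Poly_Mapping.lookup (zvar * f) k = Poly_Mapping.lookup f (k - 1)"
  and lookup_zinv_mult: "Poly_Mapping.lookup (zinv * f) k = Poly_Mapping.lookup f (k + 1)"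
  by (simp_all add: zvar_def zinv_def lookup_single_mult)

section \<open>Evaluation of Laurent polynomials at real points\<close>

lemma laurent_eval_superset:
  assumes "finite S" "Poly_Mapping.keys f \<subseteq> S"
  shows "laurent_eval f x = (\<Sum>k\<in>S. Poly_Mapping.lookup f k * x powi k)"
  unfolding laurent_eval_def using assms
  by (intro sum.mono_neutral_left) (auto simp: in_keys_iff)

lemma laurent_eval_0 [simp]: "laurent_eval 0 x = 0"
  by (simp add: laurent_eval_def)

lemma laurent_eval_add [simp]: "laurent_eval (f + g) x = laurent_eval f x + laurent_eval g x"
proof -
  let ?S = "Poly_Mapping.keys f \<union> Poly_Mapping.keys g"
  show ?thesis
    using keys_add [of f g]
    by (simp add: laurent_eval_superset [of ?S] lookup_add distrib_right sum.distrib)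
qed

lemma laurent_eval_single: "laurent_eval (Poly_Mapping.single k c) x = c * x powi k"
  by (simp add: laurent_eval_def)

lemma laurent_eval_scaleR [simp]: "laurent_eval (c *\<^sub>R f) x = c * laurent_eval f x"
  by (simp add: laurent_eval_superset [of "Poly_Mapping.keys f"] lookup_scaleR_laurent
      sum_distrib_left in_keys_iff subset_iff mult_ac)

lemma laurent_eval_diff [simp]: "laurent_eval (f - g) x = laurent_eval f x - laurent_eval g x"
  using laurent_eval_add [of "f - g" g x] by (simp del: laurent_eval_add)

lemma laurent_eval_sum [simp]: "laurent_eval (sum f S) x = (\<Sum>i\<in>S. laurent_eval (f i) x)"
  by (induction S rule: infinite_finite_induct) auto

lemma laurent_eval_mult [simp]:
  assumes "x \<noteq> 0"
  shows "laurent_eval (f * g) x = laurent_eval f x * laurent_eval g x"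
proof -
  have "f * g = (\<Sum>i\<in>Poly_Mapping.keys f. \<Sum>j\<in>Poly_Mapping.keys g. Poly_Mapping.single (i + j)
      (Poly_Mapping.lookup f i * Poly_Mapping.lookup g j))"
    by (subst laurent_expansion [of f], subst laurent_expansion [of g])
       (simp add: sum_product mult_single)
  then have "laurent_eval (f * g) x = (\<Sum>i\<in>Poly_Mapping.keys f. \<Sum>j\<in>Poly_Mapping.keys g.
      Poly_Mapping.lookup f i * Poly_Mapping.lookup g j * x powi (i + j))"
    by (simp add: laurent_eval_single)
  also have "\<dots> = laurent_eval f x * laurent_eval g x"
    unfolding laurent_eval_def sum_product
    using assms by (intro sum.cong refl) (simp add: power_int_add)
  finally show ?thesis .
qed

lemma laurent_eval_1 [simp]: "laurent_eval 1 x = 1"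
  by (simp add: laurent_eval_def)

lemma laurent_eval_zvar [simp]: "laurent_eval zvar x = x"
  and laurent_eval_zinv [simp]: "laurent_eval zinv x = 1 / x"
  by (simp_all add: zvar_def zinv_def laurent_eval_single power_int_minus divide_inverse)

lemma laurent_eval_qpoch [simp]:
  assumes "x \<noteq> 0"
  shows "laurent_eval (qpoch q f k) x = qpoch q (laurent_eval f x) k"
proof (induction k)
  case (Suc k)
  have "f * of_real (q ^ k) = q ^ k *\<^sub>R f"
    by (metis mult_scaleR_right mult.right_neutral of_real_def)
  then have "laurent_eval (f * of_real (q ^ k)) x = laurent_eval f x * q ^ k"
    by simp
  then show ?case
    using Suc assms by (simp add: qpoch_def)
qed (simp add: qpoch_def)

text \<open>For n \<ge> 1 the pair of outer coefficients determines f modulo V_(n-1); for n = 0 both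
  are the constant coefficient.\<close>

definition laurent_lead :: "nat \<Rightarrow> real \<Rightarrow> real \<Rightarrow> laurent \<Rightarrow> bool" where
  "laurent_lead n a b f \<longleftrightarrow> f \<in> laurent_space n \<and>
     Poly_Mapping.lookup f (int n) = a \<and> Poly_Mapping.lookup f (- int n) = b"

lemma laurent_lead_space: "laurent_lead n a b f \<Longrightarrow> f \<in> laurent_space n"
  by (simp add: laurent_lead_def)

lemma laurent_lead_1: "laurent_lead 0 1 1 1"
  by (auto simp: laurent_lead_def mem_laurent_space lookup_one when_def)

lemma laurent_lead_scaleR: "laurent_lead n a b f \<Longrightarrow> laurent_lead n (c * a) (c * b) (c *\<^sub>R f)"
  by (auto simp: laurent_lead_def mem_laurent_space lookup_scaleR_laurent)

lemma laurent_lead_add: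
  "laurent_lead n a b f \<Longrightarrow> laurent_lead n c d g \<Longrightarrow> laurent_lead n (a + c) (b + d) (f + g)"
  by (auto simp: laurent_lead_def mem_laurent_space lookup_add)

lemma laurent_lead_diff:
  "laurent_lead n a b f \<Longrightarrow> laurent_lead n c d g \<Longrightarrow> laurent_lead n (a - c) (b - d) (f - g)"
  by (auto simp: laurent_lead_def mem_laurent_space lookup_minus)

lemma laurent_lead_0_0: "laurent_lead (Suc n) 0 0 f \<Longrightarrow> f \<in> laurent_space n"
  by (auto simp: laurent_lead_def intro: laurent_space_Suc)

lemma laurent_lead_sum_lower:
  assumes "\<And>i. i < n \<Longrightarrow> f i \<in> laurent_space i" and "laurent_lead n a b (f n)"
  shows "laurent_lead n a b (\<Sum>i\<le>n. f i)"
proof -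
  have "laurent_lead n 0 0 (\<Sum>i<n. f i)"
    unfolding laurent_lead_def mem_laurent_space lookup_sum using assms(1)
    by (auto simp: mem_laurent_space intro!: sum.neutral)
  from laurent_lead_add [OF this assms(2)] show ?thesis
    by (simp flip: lessThan_Suc_atMost)
qed

lemma laurent_lead_mult:
  assumes "laurent_lead n a b f"
  shows "laurent_lead (Suc n) (\<beta> * a) (\<gamma> * b) ((\<alpha> *\<^sub>R 1 + \<beta> *\<^sub>R zvar + \<gamma> *\<^sub>R zinv) * f)"
  using assms unfolding laurent_lead_def mem_laurent_space
  by (auto simp: distrib_right lookup_add lookup_scaleR_laurent lookup_zvar_mult lookup_zinv_mult)

text \<open>The coefficient of z^n in (s z;q)_n.\<close>

definition lead_const :: "real \<Rightarrow> real \<Rightarrow> nat \<Rightarrow> real" where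
  "lead_const q s n = (\<Prod>i<n. - s * q ^ i)"

lemma lead_const_Suc: "lead_const q s (Suc n) = - s * q ^ n * lead_const q s n"
  by (simp add: lead_const_def)

lemma lead_const_mult: "lead_const q (q * s) n = q ^ n * lead_const q s n"
  by (induction n) (simp_all add: lead_const_Suc, simp add: lead_const_def)

lemma lead_const_nonzero: "q \<noteq> 0 \<Longrightarrow> s \<noteq> 0 \<Longrightarrow> lead_const q s n \<noteq> 0"
  by (simp add: lead_const_def)

definition qpoch_pair :: "real \<Rightarrow> real \<Rightarrow> real \<Rightarrow> nat \<Rightarrow> laurent" where
  "qpoch_pair q s t k = qpoch q (s *\<^sub>R zvar) k * qpoch q (t *\<^sub>R zinv) k"

lemma laurent_lead_qpoch_pair:
  "laurent_lead k (lead_const q s k) (lead_const q t k) (qpoch_pair q s t k)"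
proof (induction k)
  case 0
  then show ?case
    using laurent_lead_1 by (simp add: qpoch_pair_def qpoch_def lead_const_def)
next
  case (Suc k)
  have r: "f * of_real c = c *\<^sub>R f" for f :: laurent and c
    by (metis mult_scaleR_right mult.right_neutral of_real_def)
  have "qpoch_pair q s t (Suc k) = ((1 - (s * q ^ k) *\<^sub>R zvar) * (1 - (t * q ^ k) *\<^sub>R zinv)) *
      qpoch_pair q s t k"
    unfolding qpoch_pair_def qpoch_def prod.lessThan_Suc r scaleR_scaleR
    by (simp only: mult_ac)
  also have "(1 - a *\<^sub>R zvar) * (1 - b *\<^sub>R zinv) = (1 + a * b) *\<^sub>R 1 + (- a) *\<^sub>R zvar + (- b) *\<^sub>R zinv"
    for a b
    using zvar_zinv mult.commute [of zvar zinv] by (simp add: algebra_simps)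
  finally have eq: "qpoch_pair q s t (Suc k) = ((1 + s * q ^ k * (t * q ^ k)) *\<^sub>R 1 +
      (- (s * q ^ k)) *\<^sub>R zvar + (- (t * q ^ k)) *\<^sub>R zinv) * qpoch_pair q s t k" .
  show ?case
    unfolding eq lead_const_Suc
    using laurent_lead_mult [OF Suc, of "- (s * q ^ k)" "- (t * q ^ k)" "1 + s * q ^ k * (t * q ^ k)"]
    by simp
qed

text \<open>If their outer coefficients have nonzero determinant, two elements of V_(n+1) can match
  those of any third one, which leaves a remainder in V_n.\<close>

lemma laurent_space_Suc_subset_span:
  assumes f: "laurent_lead (Suc n) a b f" and g: "laurent_lead (Suc n) c d g"
    and det: "a * d \<noteq> b * c"
    and S: "laurent_space n \<subseteq> span S" "f \<in> span S" "g \<in> span S"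
  shows "laurent_space (Suc n) \<subseteq> span S"
proof
  fix p assume p: "p \<in> laurent_space (Suc n)"
  define u v where "u = Poly_Mapping.lookup p (int (Suc n))"
    and "v = Poly_Mapping.lookup p (- int (Suc n))"
  have lp: "laurent_lead (Suc n) u v p"
    using p by (simp add: laurent_lead_def u_def v_def)
  \<comment> \<open>Cramer's rule for the outer coefficients u, v of \<open>p\<close>.\<close>
  define x y where "x = (u * d - v * c) / (a * d - b * c)" and "y = (a * v - b * u) / (a * d - b * c)"
  have "x * (a * d - b * c) = u * d - v * c" "y * (a * d - b * c) = a * v - b * u"
    using det by (auto simp: x_def y_def)
  then have "(u - (x * a + y * c)) * (a * d - b * c) = 0" "(v - (x * b + y * d)) * (a * d - b * c) = 0"
    by algebra+
  then have "u - (x * a + y * c) = 0" "v - (x * b + y * d) = 0"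
    using det by auto
  then have "p - (x *\<^sub>R f + y *\<^sub>R g) \<in> laurent_space n"
    using laurent_lead_diff [OF lp laurent_lead_add [OF laurent_lead_scaleR [OF f] laurent_lead_scaleR [OF g]], of x y]
    by (intro laurent_lead_0_0) simp
  then have "p - (x *\<^sub>R f + y *\<^sub>R g) \<in> span S"
    using S by blast
  moreover have "x *\<^sub>R f + y *\<^sub>R g \<in> span S"
    using S by (intro span_add span_scale)
  ultimately show "p \<in> span S"
    using span_add by fastforce
qed

lemma laurent_space_subset_span:
  assumes base: "laurent_lead 0 a0 b0 (f 0)" "a0 \<noteq> 0"
    and step: "\<And>n. 1 \<le> n \<Longrightarrow> n \<le> N \<Longrightarrow> \<exists>a b c d. laurent_lead n a b (f n) \<and>
      laurent_lead n c d (g n) \<and> a * d \<noteq> b * c"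
  shows "laurent_space N \<subseteq> span (f ` {0..N} \<union> g ` {1..N})"
  using step
proof (induction N)
  case 0
  have "p \<in> span {f 0}" if "p \<in> laurent_space 0" for p
  proof -
    have "p = (Poly_Mapping.lookup p 0 / a0) *\<^sub>R f 0"
    proof (rule poly_mapping_eqI)
      fix k
      show "Poly_Mapping.lookup p k = Poly_Mapping.lookup ((Poly_Mapping.lookup p 0 / a0) *\<^sub>R f 0) k"
        using that base
        by (cases "k = 0") (auto simp: laurent_lead_def mem_laurent_space lookup_scaleR_laurent)
    qed
    then show ?thesis
      by (metis span_base span_scale singletonI)
  qed
  then show ?case
    by auto
next
  case (Suc N)
  let ?S = "f ` {0..Suc N} \<union> g ` {1..Suc N}"
  obtain a b c d where 1: "laurent_lead (Suc N) a b (f (Suc N))"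
    "laurent_lead (Suc N) c d (g (Suc N))" "a * d \<noteq> b * c"
    using Suc.prems [of "Suc N"] by auto
  have "laurent_space N \<subseteq> span (f ` {0..N} \<union> g ` {1..N})"
    using Suc by auto
  also have "\<dots> \<subseteq> span ?S"
    by (intro span_mono) auto
  finally show ?case
    by (intro laurent_space_Suc_subset_span [OF 1] span_base) auto
qed

text \<open>The set has at most 2N + 1 members, the dimension of V_N, so a redundant member could be
  dropped to give a spanning set that is too small. Counting the set also covers possible
  coincidences of members.\<close>

lemma laurent_space_basis:
  assumes span: "laurent_space N \<subseteq> span (f ` {0..N} \<union> g ` {1..N})"
    and f: "\<And>n. n \<le> N \<Longrightarrow> f n \<in> laurent_space n"
    and g: "\<And>n. 1 \<le> n \<Longrightarrow> n \<le> N \<Longrightarrow> g n \<in> laurent_space n"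
  shows "independent (f ` {0..N} \<union> g ` {1..N}) \<and>
    span (f ` {0..N} \<union> g ` {1..N}) = laurent_space N"
proof -
  let ?S = "f ` {0..N} \<union> g ` {1..N}"
  have sub: "?S \<subseteq> laurent_space N"
    using f g laurent_space_mono by fastforce
  have "card ?S \<le> card (f ` {0..N}) + card (g ` {1..N})"
    by (rule card_Un_le)
  also have "\<dots> \<le> card {0..N} + card {1..N}"
    by (intro add_mono card_image_le) auto
  finally have card: "card ?S \<le> real_vector.dim (laurent_space N)"
    by (simp add: dim_laurent_space)
  have "independent ?S"
  proof
    assume "dependent ?S"
    then obtain a where a: "a \<in> ?S" "a \<in> span (?S - {a})"
      by (auto simp: dependent_def)
    then have "span (?S - {a}) = span ?S"
      by (metis insert_Diff span_redundant)
    then have "real_vector.dim (laurent_space N) \<le> card (?S - {a})"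
      using span sub by (intro real_vector.span_card_ge_dim) blast+
    also have "\<dots> < card ?S"
      using a by (intro card_Diff1_less) auto
    finally show False
      using card by simp
  qed
  moreover have "span ?S \<subseteq> laurent_space N"
    by (intro span_minimal sub subspace_laurent_space)
  ultimately show ?thesis
    using span by blast
qed

subsection \<open>The coefficients of the Racah form\<close>

lemma racah_weight_Suc:
  assumes "Suc l < N \<or> Suc l = N \<and> qpoch q (q * q ^ N * A) N \<noteq> 0"
  shows "racah_weight q A B C N (Suc l) = (1 - A * (q ^ Suc l)\<^sup>2) *
     (qpoch q (q * A) l * qpoch q B (Suc l) * qpoch q C (Suc l) * qpoch q (1 / q ^ N) (Suc l)) /
     (qpoch q q (Suc l) * qpoch q (q * A / B) (Suc l) * qpoch q (q * A / C) (Suc l) *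
      qpoch q (q * q ^ N * A) (Suc l)) *
     (q * q ^ N * A / (B * C)) ^ Suc l"
proof -
  define k where "k = Suc l"
  have "(if k = N then 1 / qpoch q (q * q ^ N * A) (N - 1)
            else (1 - A * (q ^ k)\<^sup>2) / qpoch q (q * q ^ N * A) k)
    = (1 - A * (q ^ k)\<^sup>2) / qpoch q (q * q ^ N * A) k"
  proof (cases "k = N")
    case True
    have 1: "qpoch q (q * q ^ N * A) N = qpoch q (q * q ^ N * A) l * (1 - A * (q ^ N)\<^sup>2)"
      unfolding True [symmetric] k_def qpoch_Suc by (simp add: power2_eq_square mult_ac)
    have "qpoch q (q * q ^ N * A) N \<noteq> 0"
      using assms True k_def by auto
    moreover have "N - 1 = l"
      using True k_def by simp
    ultimately show ?thesis
      using True 1 by simp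
  qed simp
  moreover have "k \<noteq> 0" "k - 1 = l"
    by (simp_all add: k_def)
  ultimately show ?thesis
    unfolding racah_weight_def k_def [symmetric] by (simp add: mult_ac)
qed

text \<open>The usual very-well-poised expression, with 1 - A moved to the left because A = 1 is
  possible.\<close>

lemma racah_weight_eq:
  assumes "k < N \<or> k \<le> N \<and> qpoch q (q * q ^ N * A) N \<noteq> 0"
  shows "(1 - A) * racah_weight q A B C N k = (1 - A * (q ^ k)\<^sup>2) *
     (qpoch q A k * qpoch q B k * qpoch q C k * qpoch q (1 / q ^ N) k) /
     (qpoch q q k * qpoch q (q * A / B) k * qpoch q (q * A / C) k * qpoch q (q * q ^ N * A) k) *
     (q * q ^ N * A / (B * C)) ^ k"
proof (cases k)
  case 0
  then show ?thesis
    by (simp add: racah_weight_def)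
next
  case (Suc l)
  have "Suc l < N \<or> Suc l = N \<and> qpoch q (q * q ^ N * A) N \<noteq> 0"
    using assms Suc by auto
  from racah_weight_Suc [OF this, of B C] show ?thesis
    unfolding Suc qpoch_Suc_shift [of q A] by (simp add: mult_ac del: power_Suc)
qed

text \<open>The two alternatives are the two nodes of a pair: they exchange the values of s z and t
  / z. Hence the product takes the same value at both.\<close>

lemma laurent_eval_qpoch_pair:
  assumes "x \<noteq> 0"
    and "s * x = A * q ^ k \<and> t / x = 1 / q ^ k \<or> s * x = 1 / q ^ k \<and> t / x = A * q ^ k"
  shows "laurent_eval (qpoch_pair q s t j) x = racah_e q A j k"
  using assms by (auto simp: qpoch_pair_def racah_e_def)

lemma phi43_expand:
  assumes "q \<noteq> 0"
  shows "phi43 q (q powi (- int n)) a2 (s *\<^sub>R zvar) (t *\<^sub>R zinv) b1 b2 b3 =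
     (\<Sum>k\<le>n. (qpoch q (1 / q ^ n) k * qpoch q a2 k /
              (qpoch q q k * qpoch q b1 k * qpoch q b2 k * qpoch q b3 k) * q ^ k)
             *\<^sub>R qpoch_pair q s t k)"
  unfolding phi43_terminating [OF assms] qpoch_pair_def
  by (simp add: power_int_minus inverse_eq_divide)

lemma laurent_eval_phi43:
  assumes "q \<noteq> 0" "x \<noteq> 0"
    and "s * x = A * q ^ k \<and> t / x = 1 / q ^ k \<or> s * x = 1 / q ^ k \<and> t / x = A * q ^ k"
    and "a2 = B * C / (A * q ^ N) * q ^ n / q" and "b3 = 1 / q ^ N"
  shows "laurent_eval (phi43 q (q powi (- int n)) a2 (s *\<^sub>R zvar) (t *\<^sub>R zinv) B C b3) x
    = racah_phi q A B C N n k"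
  unfolding phi43_expand [OF assms(1)] racah_phi_def assms(4,5)
  by (simp add: laurent_eval_qpoch_pair [OF assms(2,3)])

text \<open>Term i of the series lies in V_i, so only the last term reaches the outer
  coefficients.\<close>

lemma laurent_lead_phi43:
  fixes n :: nat and q a2 b1 b2 b3 s t :: real
  assumes "q \<noteq> 0"
  defines "\<kappa> \<equiv> qpoch q (1 / q ^ n) n * qpoch q a2 n /
     (qpoch q q n * qpoch q b1 n * qpoch q b2 n * qpoch q b3 n) * q ^ n"
  shows "laurent_lead n (\<kappa> * lead_const q s n) (\<kappa> * lead_const q t n)
    (phi43 q (q powi (- int n)) a2 (s *\<^sub>R zvar) (t *\<^sub>R zinv) b1 b2 b3)"
  unfolding phi43_expand [OF assms(1)]
proof (rule laurent_lead_sum_lower)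
  fix i
  show "(qpoch q (1 / q ^ n) i * qpoch q a2 i /
     (qpoch q q i * qpoch q b1 i * qpoch q b2 i * qpoch q b3 i) * q ^ i) *\<^sub>R qpoch_pair q s t i
    \<in> laurent_space i"
    by (intro subspace_scale subspace_laurent_space laurent_lead_space [OF laurent_lead_qpoch_pair])
next
  show "laurent_lead n (\<kappa> * lead_const q s n) (\<kappa> * lead_const q t n)
    ((qpoch q (1 / q ^ n) n * qpoch q a2 n /
     (qpoch q q n * qpoch q b1 n * qpoch q b2 n * qpoch q b3 n) * q ^ n) *\<^sub>R qpoch_pair q s t n)"
    unfolding \<kappa>_def by (intro laurent_lead_scaleR laurent_lead_qpoch_pair)
qed

text \<open>The case j = 4; the case j = 3 will follow by exchanging t3 and t4. Condition
  \<open>nd\<close> keeps factors such as (t1 t2 t3 t4 q^(n-1);q)_n in the leading coefficients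
  nonzero.\<close>

locale racah_setup =
  fixes q t1 t2 t3 t4 :: real and N :: nat
  assumes q: "0 < q" "q < 1" and N: "1 \<le> N"
    and t14: "t1 * t4 = 1 / q ^ N"
    and wd: "racah_well_defined N q t1 t2 t3 t4"
    and nd: "\<forall>m \<le> 2 * N - 2. t1 * t2 * t3 * t4 * q ^ m \<noteq> 1"
begin

text \<open>Together with t1 t4 = q^-N these are the q-Racah parameters of R_n. The other families
  use them multiplied by powers of q, some with N - 1 for N. The ratio \<open>\<rho>\<close> is q /
  (t1 t2 t3 t4).\<close>

definition A :: real where "A = t1\<^sup>2"
definition B :: real where "B = t1 * t2"
definition C :: real where "C = t1 * t3"
definition \<rho> :: real where "\<rho> = q * q ^ N * A / (B * C)"

abbreviation "P \<equiv> t1 * t2 * t3 * t4"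

lemma q0: "q \<noteq> 0"
  using q by simp

lemma t_nonzero: "t1 \<noteq> 0" "t2 \<noteq> 0" "t3 \<noteq> 0" "t4 \<noteq> 0"
  using t14 q wd by (auto simp: racah_well_defined_def)

lemma ABC_nonzero: "A \<noteq> 0" "B \<noteq> 0" "C \<noteq> 0" "\<rho> \<noteq> 0"
  using t_nonzero q0 by (auto simp: A_def B_def C_def \<rho>_def)

lemma t4_eq: "t4 = 1 / (q ^ N * t1)"
  using t14 t_nonzero q0 by (simp add: field_simps)

lemma P_eq: "P = B * C / (A * q ^ N)"
  using t_nonzero by (simp add: t4_eq A_def B_def C_def field_simps power2_eq_square)

lemma ratios: "q * t1 / t2 = q * A / B" "q * t1 / t3 = q * A / C" "q * t1 / t4 = q * q ^ N * A"
  "q / P = \<rho>"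
  using t_nonzero q0 unfolding P_eq \<rho>_def by (auto simp: t4_eq A_def B_def C_def power2_eq_square)

lemma lower_nonzero: "k \<le> N \<Longrightarrow> qpoch q (q * A / B) k \<noteq> 0"
    "k \<le> N \<Longrightarrow> qpoch q (q * A / C) k \<noteq> 0" "k \<le> N \<Longrightarrow> qpoch q (q * q ^ N * A) k \<noteq> 0"
  using wd qpoch_nonzero_mono [of q "q * A / B" N k] qpoch_nonzero_mono [of q "q * A / C" N k]
    qpoch_nonzero_mono [of q "q * q ^ N * A" N k]
  by (auto simp: racah_well_defined_def ratios)

lemma upper_nonzero: "k \<le> Suc N \<Longrightarrow> qpoch q B k \<noteq> 0"
    "k \<le> N \<Longrightarrow> qpoch q C k \<noteq> 0"
  using wd qpoch_nonzero_mono [of q B "Suc N" k] qpoch_nonzero_mono [of q C N k]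
  by (auto simp: racah_well_defined_def B_def C_def)

text \<open>The coefficients of the form at t1 q^k, written in A, B, C and N; \<open>racah_b\<close>
  gives those at 1 / (t1 q^k).\<close>

definition racah_a :: "nat \<Rightarrow> real" where
  "racah_a k = qpoch q (q * A) (k - 1) * qpoch q (q * B) (k - 1) *
     qpoch q C k * qpoch q (1 / q ^ N) k /
     (qpoch q (q * A / B) (k - 1) * qpoch q q (k - 1) *
      qpoch q (q * A / C) k * qpoch q (q * q ^ N * A) k) * \<rho> ^ k * (- B)"

definition racah_b :: "nat \<Rightarrow> real" where
  "racah_b k = qpoch q (q * A) k * qpoch q (q * B) k *
     qpoch q C k * qpoch q (1 / q ^ N) k /
     (qpoch q (q * A / B) k * qpoch q (q * A / C) k * qpoch q (q * q ^ N * A) k * qpoch q q k)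
     * \<rho> ^ k"

definition racah_sum :: "(real \<Rightarrow> real) \<Rightarrow> real" where
  "racah_sum F = (\<Sum>k=1..N. racah_a k * F (t1 * q ^ k)) + (\<Sum>k=0..N. racah_b k * F (1 / (t1 * q ^ k)))"

lemma racah_form_eq:
  "racah_form N q t1 t2 t3 t4 f g = racah_sum (\<lambda>x. laurent_eval f x * laurent_eval g x)"
proof -
  have 1: "q powi (- int k) / t1 = 1 / (t1 * q ^ k)" for k
    by (simp add: power_int_minus divide_inverse)
  have 2: "q * t1 * t2 = q * B" "t1 * t2 = B"
    by (simp_all add: B_def)
  show ?thesis
    unfolding racah_form_def racah_sum_def racah_a_def racah_b_def ratios t14 1
    unfolding 2 A_def [symmetric] C_def [symmetric]
    by (simp only: mult.assoc)
qed

definition h :: "real \<Rightarrow> real" where "h x = 1 / x * (1 - t1 * x) * (1 - t2 * x)"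
definition h2 :: "real \<Rightarrow> real" where "h2 x = x * (1 - t3 / x) * (1 - t4 / x)"

text \<open>
  A common factor of the coefficients at \<open>z = t1 q^(l+1)\<close> and at \<open>1/z\<close>; \<open>racah_base'\<close> below is
  a common factor of those at \<open>z\<close> and at \<open>q/z\<close>.
\<close>

definition racah_base :: "nat \<Rightarrow> real" where
  "racah_base l = qpoch q (q * A) l * qpoch q (q * B) l *
     qpoch q C (Suc l) * qpoch q (1 / q ^ N) (Suc l) /
     (qpoch q (q * A / B) (Suc l) * qpoch q (q * A / C) (Suc l) *
      qpoch q (q * q ^ N * A) (Suc l) * qpoch q q (Suc l)) * \<rho> ^ Suc l"

lemma lin_nonzero:
  assumes "l < N"
  shows "1 - q ^ Suc l \<noteq> 0" "1 - A * q ^ Suc l / B \<noteq> 0" "1 - A * q ^ Suc l / C \<noteq> 0"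
    "1 - A * q ^ Suc l * q ^ N \<noteq> 0"
  using lower_nonzero [of "Suc l"] qpoch_self_nonzero [OF q, of "Suc l"] assms
  by (simp_all add: qpoch_Suc mult_ac)

lemma racah_a_Suc:
  assumes "l < N"
  shows "racah_a (Suc l) = racah_base l * ((1 - A * q ^ Suc l / B) * (1 - q ^ Suc l)) * (- B)"
proof -
  have 1: "qpoch q (q * A / B) (Suc l) = qpoch q (q * A / B) l * (1 - A * q ^ Suc l / B)"
    "qpoch q q (Suc l) = qpoch q q l * (1 - q ^ Suc l)"
    by (simp_all add: qpoch_Suc mult_ac)
  show ?thesis
    using lin_nonzero [OF assms] unfolding racah_a_def racah_base_def 1 by (simp add: mult_ac ABC_nonzero q0)
qed

lemma racah_b_Suc:
  "racah_b (Suc l) = racah_base l * ((1 - A * q ^ Suc l) * (1 - B * q ^ Suc l))"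
proof -
  have 1: "qpoch q (q * A) (Suc l) = qpoch q (q * A) l * (1 - A * q ^ Suc l)"
    "qpoch q (q * B) (Suc l) = qpoch q (q * B) l * (1 - B * q ^ Suc l)"
    by (simp_all add: qpoch_Suc mult_ac)
  show ?thesis
    unfolding racah_b_def racah_base_def 1 by (simp add: mult_ac ABC_nonzero q0)
qed

definition racah_base' :: "nat \<Rightarrow> real" where
  "racah_base' l = qpoch q (q * A) l * qpoch q (q * B) l * qpoch q C l * qpoch q (1 / q ^ N) l /
     (qpoch q (q * A / B) l * qpoch q (q * A / C) (Suc l) *
      qpoch q (q * q ^ N * A) (Suc l) * qpoch q q l) * \<rho> ^ l"

lemma racah_b_prev:
  assumes "l < N"
  shows "racah_b l = racah_base' l * ((1 - A * q ^ Suc l / C) * (1 - A * q ^ Suc l * q ^ N))"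
proof -
  have 1: "qpoch q (q * A / C) (Suc l) = qpoch q (q * A / C) l * (1 - A * q ^ Suc l / C)"
    "qpoch q (q * q ^ N * A) (Suc l) = qpoch q (q * q ^ N * A) l * (1 - A * q ^ Suc l * q ^ N)"
    by (simp_all add: qpoch_Suc mult_ac)
  show ?thesis
    using lin_nonzero [OF assms(1)] unfolding racah_b_def racah_base'_def 1
    by (simp add: mult_ac ABC_nonzero q0)
qed

lemma racah_a_next:
  "racah_a (Suc l) = racah_base' l * ((1 - C * q ^ l) * (1 - q ^ l / q ^ N)) * (- B * \<rho>)"
proof -
  have 1: "qpoch q C (Suc l) = qpoch q C l * (1 - C * q ^ l)"
    "qpoch q (1 / q ^ N) (Suc l) = qpoch q (1 / q ^ N) l * (1 - q ^ l / q ^ N)"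
    by (simp_all add: qpoch_Suc mult_ac)
  show ?thesis
    unfolding racah_a_def racah_base'_def 1 by (simp add: mult_ac)
qed

text \<open>Beyond \<open>racah_base l\<close>, the linear factors of \<open>racah_a (Suc l)\<close>
  are up to a monomial those of \<open>h (1 / x)\<close>, and those of
  \<open>racah_b (Suc l)\<close> are those of \<open>h x\<close>. So the two products agree up to
  sign.\<close>

lemma h_pair:
  assumes "l < N"
  defines "x \<equiv> t1 * q ^ Suc l"
  shows "racah_a (Suc l) * h x + racah_b (Suc l) * h (1 / x) = 0"
proof -
  define u where "u = q ^ Suc l"
  have u: "u \<noteq> 0" using q0 by (simp add: u_def)
  have "(1 - A * u / B) * (1 - u) * (- B) * h x + (1 - A * u) * (1 - B * u) * h (1 / x) = 0"
    using u t_nonzero unfolding h_def x_def u_def [symmetric] A_def B_def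
    by (simp add: divide_simps) algebra
  then show ?thesis
    unfolding racah_a_Suc [OF assms(1)] racah_b_Suc u_def [symmetric]
    by (metis (no_types, lifting) distrib_left mult.assoc mult_zero_right)
qed

text \<open>The same mechanism for z \<mapsto> q/z, which joins t1 q^(l+1) with 1 / (t1
  q^l).\<close>

lemma h2_pair:
  assumes "l < N"
  shows "racah_a (Suc l) * h2 (t1 * q ^ Suc l) + racah_b l * h2 (1 / (t1 * q ^ l)) = 0"
proof -
  define v d where "v = q ^ l" and "d = q ^ N"
  have v: "v \<noteq> 0" "d \<noteq> 0" using q0 by (simp_all add: v_def d_def)
  have "(1 - C * v) * (1 - v / d) * (- B * \<rho>) * h2 (t1 * (q * v))
      + (1 - A * (q * v) / C) * (1 - A * (q * v) * d) * h2 (1 / (t1 * v)) = 0"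
    using v t_nonzero q0 unfolding h2_def unfolding \<rho>_def d_def [symmetric] t4_eq A_def B_def C_def
    by (simp add: divide_simps) algebra
  then have "racah_base' l * ((1 - C * v) * (1 - v / d) * (- B * \<rho>) * h2 (t1 * (q * v))
      + (1 - A * (q * v) / C) * (1 - A * (q * v) * d) * h2 (1 / (t1 * v))) = 0"
    by simp
  then show ?thesis
    unfolding racah_a_next racah_b_prev [OF assms] power_Suc v_def [symmetric] d_def [symmetric]
    by (simp only: distrib_left mult.assoc)
qed

text \<open>The node 1 / t1 has no partner under inversion, as the first sum of the form starts at k
  = 1. Under z \<mapsto> q/z the node left over is 1 / (t1 q^N). At each of them the respective
  multiplier vanishes.\<close>

lemma h_at_0: "h (1 / t1) = 0"
  using t_nonzero by (simp add: h_def)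

lemma h2_at_N: "h2 (1 / (t1 * q ^ N)) = 0"
  using t_nonzero unfolding h2_def unfolding t4_eq by (simp add: mult_ac q0)

lemma racah_sum_reindex:
  "racah_sum F = (\<Sum>l<N. racah_a (Suc l) * F (t1 * q ^ Suc l)) + (\<Sum>k\<le>N. racah_b k * F (1 / (t1 * q ^ k)))"
proof -
  have "(\<Sum>k=1..N. racah_a k * F (t1 * q ^ k)) = (\<Sum>l<N. racah_a (Suc l) * F (t1 * q ^ Suc l))"
    by (rule sum.reindex_bij_witness [of _ Suc "\<lambda>k. k - 1"]) auto
  then show ?thesis
    unfolding racah_sum_def by (simp add: atMost_atLeast0)
qed

text \<open>Paired coefficients are opposite after multiplication by \<open>h\<close>, so only
  differences of G at paired nodes survive. For G invariant under inversion the sum is therefore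
  zero.\<close>

lemma racah_sum_h:
  "racah_sum (\<lambda>x. h x * G x) =
    (\<Sum>l<N. racah_a (Suc l) * h (t1 * q ^ Suc l) * (G (t1 * q ^ Suc l) - G (1 / (t1 * q ^ Suc l))))"
proof -
  obtain M where M: "N = Suc M"
    using N by (cases N) auto
  have "(\<Sum>k\<le>N. racah_b k * (h (1 / (t1 * q ^ k)) * G (1 / (t1 * q ^ k))))
    = (\<Sum>l<N. racah_b (Suc l) * (h (1 / (t1 * q ^ Suc l)) * G (1 / (t1 * q ^ Suc l))))"
    unfolding sum.atMost_shift using h_at_0 by simp
  moreover have "racah_b (Suc l) * (h (1 / (t1 * q ^ Suc l)) * G (1 / (t1 * q ^ Suc l)))
    = - (racah_a (Suc l) * h (t1 * q ^ Suc l) * G (1 / (t1 * q ^ Suc l)))" if "l < N" for l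
  proof -
    have "racah_b (Suc l) * h (1 / (t1 * q ^ Suc l)) = - (racah_a (Suc l) * h (t1 * q ^ Suc l))"
      using h_pair [OF that] by linarith
    then show ?thesis
      by (simp only: mult.assoc [symmetric] mult_minus_left)
  qed
  ultimately show ?thesis
    unfolding racah_sum_reindex by (simp add: sum_negf right_diff_distrib sum_subtractf mult_ac)
qed

lemma racah_sum_h2:
  "racah_sum (\<lambda>x. h2 x * G x) =
    (\<Sum>l<N. racah_a (Suc l) * h2 (t1 * q ^ Suc l) * (G (t1 * q ^ Suc l) - G (1 / (t1 * q ^ l))))"
proof -
  have "(\<Sum>k\<le>N. racah_b k * (h2 (1 / (t1 * q ^ k)) * G (1 / (t1 * q ^ k))))
    = (\<Sum>l<N. racah_b l * (h2 (1 / (t1 * q ^ l)) * G (1 / (t1 * q ^ l))))"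
    using h2_at_N by (simp flip: lessThan_Suc_atMost)
  moreover have "racah_b l * (h2 (1 / (t1 * q ^ l)) * G (1 / (t1 * q ^ l)))
    = - (racah_a (Suc l) * h2 (t1 * q ^ Suc l) * G (1 / (t1 * q ^ l)))" if "l < N" for l
  proof -
    have "racah_b l * h2 (1 / (t1 * q ^ l)) = - (racah_a (Suc l) * h2 (t1 * q ^ Suc l))"
      using h2_pair [OF that] by linarith
    then show ?thesis
      by (simp only: mult.assoc [symmetric] mult_minus_left)
  qed
  ultimately show ?thesis
    unfolding racah_sum_reindex by (simp add: sum_negf right_diff_distrib sum_subtractf mult_ac)
qed

text \<open>On functions invariant under inversion the form sees only sums of paired coefficients.
  With \<open>racah_b 0\<close> = 1 at the unpaired node these sums form the weight for A, B,
  C.\<close>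

lemma weight_R:
  assumes "l < N"
  shows "racah_a (Suc l) + racah_b (Suc l) = racah_weight q A B C N (Suc l)"
proof -
  define u where "u = q ^ Suc l"
  have "Suc l < N \<or> Suc l = N \<and> qpoch q (q * q ^ N * A) N \<noteq> 0"
    using assms lower_nonzero(3) [of N] by auto
  note W = racah_weight_Suc [OF this, of B C]
  have 1: "racah_weight q A B C N (Suc l) = racah_base l * ((1 - A * u\<^sup>2) * (1 - B))"
    unfolding W racah_base_def qpoch_Suc_shift [of q B] u_def \<rho>_def
    by (simp add: mult_ac)
  have 2: "(1 - A * u / B) * (1 - u) * (- B) + (1 - A * u) * (1 - B * u) = (1 - A * u\<^sup>2) * (1 - B)"
    using ABC_nonzero by (simp add: field_simps power2_eq_square)
  show ?thesis
    unfolding racah_a_Suc [OF assms] racah_b_Suc u_def [symmetric] 1 2 [symmetric]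
    by (simp only: distrib_left mult.assoc)
qed

text \<open>Testing U_n against z times an invariant function leaves the factor x - 1/x. Including
  it, the coefficients are proportional to the weight for q^2 A, q^2 B, q C on the N points 0, ...,
  N - 1.\<close>

lemma weight_U:
  "\<exists>K. \<forall>l<N. racah_a (Suc l) * h (t1 * q ^ Suc l) * (t1 * q ^ Suc l - 1 / (t1 * q ^ Suc l))
     = K * racah_weight q (q * (q * A)) (q * (q * B)) (q * C) (N - 1) l"
proof (intro exI allI impI)
  fix l assume l: "l < N"
  define u v where "u = q ^ Suc l" and "v = q ^ l"
  have u: "u \<noteq> 0" "v \<noteq> 0" "u = q * v"
    using q0 by (simp_all add: u_def v_def)
  have N': "q ^ N = q * q ^ (N - 1)"
    using N by (cases N) auto
  have s: "q * (q * (q * A)) / (q * (q * B)) = q * A / B"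
    "q * (q * (q * A)) / (q * C) = q * (q * A / C)"
    "q * q ^ (N - 1) * (q * (q * A)) = q * (q * q ^ N * A)"
    "1 / q ^ (N - 1) = q * (1 / q ^ N)"
    "q * (q * q ^ N * A) / (q * (q * B) * (q * C)) = \<rho> / q ^ 2"
    using q0 by (simp_all add: N' \<rho>_def power2_eq_square)
  have "qpoch q (q * (q * q ^ N * A)) (N - 1) \<noteq> 0"
    using lower_nonzero(3) [of N] N by (intro qpoch_nonzero_shift [of _ _ N]) auto
  then have "l < N - 1 \<or> l \<le> N - 1 \<and> qpoch q (q * q ^ (N - 1) * (q * (q * A))) (N - 1) \<noteq> 0"
    unfolding s using l by auto
  note 1 = racah_weight_eq [OF this, of "q * (q * B)" "q * C", unfolded s]
  define E where "E = (qpoch q (q * (q * A)) l * qpoch q (q * (q * B)) l * qpoch q (q * C) l *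
      qpoch q (q * (1 / q ^ N)) l) / (qpoch q q l * qpoch q (q * A / B) l *
      qpoch q (q * (q * A / C)) l * qpoch q (q * (q * q ^ N * A)) l) * \<rho> ^ l"
  have W: "(1 - q * (q * A)) * racah_weight q (q * (q * A)) (q * (q * B)) (q * C) (N - 1) l
    = (1 - A * u\<^sup>2) * E / v\<^sup>2"
    unfolding 1 E_def u(3) power_divide v_def [symmetric]
    by (simp add: power2_eq_square mult_ac v_def power_mult_distrib)
  \<comment> \<open>The factors independent of l that are released when the q-shifted factorials
    pass to the shifted parameters in \<open>E\<close>.\<close>
  define K0 where "K0 = (1 - q * A) * (1 - q * B) * (1 - C) * (1 - 1 / q ^ N) /
     ((1 - q * A / C) * (1 - q * q ^ N * A)) * \<rho>"
  have base: "racah_base l * ((1 - A * u / B) * (1 - u) * (1 - A * u) * (1 - B * u)) = K0 * E"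
  proof -
    have a: "qpoch q (q * A) l * (1 - A * u) = (1 - q * A) * qpoch q (q * (q * A)) l"
      "qpoch q (q * B) l * (1 - B * u) = (1 - q * B) * qpoch q (q * (q * B)) l"
      using qpoch_shift_mult [of "q * A" q l] qpoch_shift_mult [of "q * B" q l]
      by (simp_all add: u_def mult_ac)
    have b: "qpoch q (q * A / B) (Suc l) = qpoch q (q * A / B) l * (1 - A * u / B)"
      "qpoch q q (Suc l) = qpoch q q l * (1 - u)"
      by (simp_all add: qpoch_Suc u_def mult_ac)
    have "racah_base l * ((1 - A * u / B) * (1 - u) * (1 - A * u) * (1 - B * u))
      = (qpoch q (q * A) l * (1 - A * u)) * (qpoch q (q * B) l * (1 - B * u)) *
     qpoch q C (Suc l) * qpoch q (1 / q ^ N) (Suc l) /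
     (qpoch q (q * A / B) l * qpoch q (q * A / C) (Suc l) *
      qpoch q (q * q ^ N * A) (Suc l) * qpoch q q l) * \<rho> ^ Suc l"
      using lin_nonzero [OF l] unfolding racah_base_def b u_def [symmetric]
      by (simp add: mult_ac ABC_nonzero q0)
    also have "\<dots> = K0 * E"
      unfolding a K0_def E_def qpoch_Suc_shift power_Suc by (simp add: mult_ac)
    finally show ?thesis .
  qed
  have hx: "h (t1 * u) * (t1 * u - 1 / (t1 * u)) = - ((1 - A * u) * (1 - B * u) * (1 - A * u\<^sup>2) / (A * u\<^sup>2))"
    using t_nonzero u by (simp add: h_def A_def B_def field_simps power2_eq_square)
  have "racah_a (Suc l) * h (t1 * u) * (t1 * u - 1 / (t1 * u))
    = racah_base l * ((1 - A * u / B) * (1 - u) * (1 - A * u) * (1 - B * u)) * (1 - A * u\<^sup>2) / (A * u\<^sup>2) * B"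
    unfolding mult.assoc [of "racah_a (Suc l)"] hx
    unfolding racah_a_Suc [OF l] u_def [symmetric] by (simp add: mult_ac)
  also have "\<dots> = K0 * B / (A * q\<^sup>2) * ((1 - A * u\<^sup>2) * E / v\<^sup>2)"
    unfolding base unfolding u(3) by (simp add: power_mult_distrib mult_ac)
  also have "\<dots> = K0 * B / (A * q\<^sup>2) * (1 - q * (q * A)) *
      racah_weight q (q * (q * A)) (q * (q * B)) (q * C) (N - 1) l"
    unfolding W [symmetric] by (simp add: mult_ac)
  finally show "racah_a (Suc l) * h (t1 * q ^ Suc l) * (t1 * q ^ Suc l - 1 / (t1 * q ^ Suc l))
    = (1 - q * A) * (1 - q * B) * (1 - C) * (1 - 1 / q ^ N) /
     ((1 - q * A / C) * (1 - q * q ^ N * A)) * \<rho> * B / (A * q\<^sup>2) * (1 - q * (q * A)) *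
      racah_weight q (q * (q * A)) (q * (q * B)) (q * C) (N - 1) l"
    unfolding u_def K0_def .
qed

text \<open>The analogue for z \<mapsto> q/z: the factor is x - q/x and the parameters are q A, q B,
  q C.\<close>

lemma weight_S:
  "\<exists>K. \<forall>l<N. racah_a (Suc l) * h2 (t1 * q ^ Suc l) * (t1 * q ^ Suc l - 1 / (t1 * q ^ l))
     = K * racah_weight q (q * A) (q * B) (q * C) (N - 1) l"
proof (intro exI allI impI)
  fix l assume l: "l < N"
  define d v where "d = q ^ N" and "v = q ^ l"
  have v: "d \<noteq> 0" "v \<noteq> 0"
    using q0 by (simp_all add: d_def v_def)
  have N': "q ^ N = q * q ^ (N - 1)"
    using N by (cases N) auto
  have s: "q * (q * A) / (q * B) = q * A / B"
    "q * (q * A) / (q * C) = q * A / C"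
    "q * q ^ (N - 1) * (q * A) = q * q ^ N * A"
    "1 / q ^ (N - 1) = q * (1 / q ^ N)"
    "q * q ^ N * A / (q * B * (q * C)) = \<rho> / q ^ 2"
    using q0 by (simp_all add: N' \<rho>_def power2_eq_square)
  have "qpoch q (q * q ^ N * A) (N - 1) \<noteq> 0"
    using lower_nonzero(3) by auto
  then have "l < N - 1 \<or> l \<le> N - 1 \<and> qpoch q (q * q ^ (N - 1) * (q * A)) (N - 1) \<noteq> 0"
    unfolding s using l by auto
  note 1 = racah_weight_eq [OF this, of "q * B" "q * C", unfolded s]
  define E where "E = (qpoch q (q * A) l * qpoch q (q * B) l * qpoch q (q * C) l *
      qpoch q (q * (1 / q ^ N)) l) / (qpoch q q l * qpoch q (q * A / B) l *
      qpoch q (q * A / C) l * qpoch q (q * q ^ N * A) l) * \<rho> ^ l"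
  have W: "(1 - q * A) * racah_weight q (q * A) (q * B) (q * C) (N - 1) l
    = (1 - q * A * v\<^sup>2) * E / v\<^sup>2"
    unfolding 1 E_def power_divide v_def [symmetric]
    by (simp add: power2_eq_square mult_ac v_def power_mult_distrib)
  have base: "racah_base' l * ((1 - C * v) * (1 - v / d) * (1 - A * (q * v) / C) * (1 - A * (q * v) * d))
    = (1 - C) * (1 - 1 / d) * E"
  proof -
    have a: "qpoch q C l * (1 - C * v) = (1 - C) * qpoch q (q * C) l"
      "qpoch q (1 / q ^ N) l * (1 - v / d) = (1 - 1 / d) * qpoch q (q * (1 / q ^ N)) l"
      using qpoch_shift_mult [of C q l] qpoch_shift_mult [of "1 / q ^ N" q l]
      by (simp_all add: v_def d_def mult_ac)
    have b: "qpoch q (q * A / C) (Suc l) = qpoch q (q * A / C) l * (1 - A * (q * v) / C)"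
      "qpoch q (q * q ^ N * A) (Suc l) = qpoch q (q * q ^ N * A) l * (1 - A * (q * v) * d)"
      by (simp_all add: qpoch_Suc v_def d_def mult_ac)
    have "racah_base' l * ((1 - C * v) * (1 - v / d) * (1 - A * (q * v) / C) * (1 - A * (q * v) * d))
      = qpoch q (q * A) l * qpoch q (q * B) l * (qpoch q C l * (1 - C * v)) *
        (qpoch q (1 / q ^ N) l * (1 - v / d)) /
       (qpoch q (q * A / B) l * qpoch q (q * A / C) l *
      qpoch q (q * q ^ N * A) l * qpoch q q l) * \<rho> ^ l"
      using lin_nonzero [OF l] unfolding racah_base'_def b
      unfolding power_Suc v_def [symmetric] d_def [symmetric]
      by (simp add: mult_ac ABC_nonzero q0)
    also have "\<dots> = (1 - C) * (1 - 1 / d) * E"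
      unfolding a E_def by (simp add: mult_ac)
    finally show ?thesis .
  qed
  have hx: "h2 (t1 * (q * v)) * (t1 * (q * v) - 1 / (t1 * v))
    = - ((1 - A * (q * v) / C) * (1 - A * (q * v) * d) * (1 - q * A * v\<^sup>2) * (C / (A\<^sup>2 * q * d * v\<^sup>2)))"
    using t_nonzero v q0 unfolding h2_def unfolding t4_eq d_def [symmetric] A_def C_def
    by (simp add: divide_simps) algebra
  have "racah_a (Suc l) * h2 (t1 * (q * v)) * (t1 * (q * v) - 1 / (t1 * v))
    = racah_base' l * ((1 - C * v) * (1 - v / d) * (1 - A * (q * v) / C) * (1 - A * (q * v) * d)) *
       (B * \<rho> * (1 - q * A * v\<^sup>2) * (C / (A\<^sup>2 * q * d * v\<^sup>2)))"
    unfolding mult.assoc [of "racah_a (Suc l)"] hx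
    unfolding racah_a_next v_def [symmetric] d_def [symmetric] by (simp add: mult_ac)
  also have "\<dots> = (1 - C) * (1 - 1 / d) * (B * \<rho> * C / (A\<^sup>2 * q * d)) * ((1 - q * A * v\<^sup>2) * E / v\<^sup>2)"
    unfolding base by (simp add: mult_ac)
  finally show "racah_a (Suc l) * h2 (t1 * q ^ Suc l) * (t1 * q ^ Suc l - 1 / (t1 * q ^ l))
    = (1 - C) * (1 - 1 / q ^ N) * (B * \<rho> * C / (A\<^sup>2 * q * q ^ N)) * (1 - q * A) *
       racah_weight q (q * A) (q * B) (q * C) (N - 1) l"
    unfolding W [symmetric] by (simp only: d_def v_def power_Suc mult.assoc)
qed

lemma C_ratio: "t3 * t4 = C / (A * q ^ N)"
  using t_nonzero by (simp add: t4_eq A_def C_def power2_eq_square)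

text \<open>Coefficients paired by z \<mapsto> q/z add up to the weight for q A, q B, C, and the
  coefficient at 1 / (t1 q^N) stands alone as the value at N. The hypothesis keeps 1 - q^(N+1) A /
  C, the last factor of the shifted denominator, nonzero.\<close>

lemma weight_T:
  assumes "t3 * t4 \<noteq> q"
  shows "\<exists>K. (\<forall>l<N. racah_b l + racah_a (Suc l) = K * racah_weight q (q * A) (q * B) C N l)
    \<and> racah_b N = K * racah_weight q (q * A) (q * B) C N N"
proof (intro exI conjI allI impI)
  define d where "d = q ^ N"
  have d: "d \<noteq> 0"
    using q0 by (simp add: d_def)
  define K where "K = (1 - q * A) * (1 - q * A * d / C) / ((1 - q * A / C) * (1 - q * d * A))"
  have s: "q * (q * A) / (q * B) = q * A / B"
    "q * (q * A) / C = q * (q * A / C)"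
    "q * q ^ N * (q * A) = q * (q * q ^ N * A)"
    "q * (q * q ^ N * A) / (q * B * C) = \<rho>"
    using q0 by (simp_all add: \<rho>_def)
  {
    fix l assume l: "l < N"
    define v where "v = q ^ l"
    have v: "v \<noteq> 0"
      using q0 by (simp add: v_def)
    note W = racah_weight_eq [OF disjI1 [OF l], where q = q and A = "q * A" and B = "q * B" and C = C, unfolded s]
    have 1: "(1 - A * (q * v) / C) * (1 - A * (q * v) * d) +
        (1 - C * v) * (1 - v / d) * (- B * \<rho>)
      = (1 - q * A * d / C) * (1 - q * A * v\<^sup>2)"
      using ABC_nonzero v d q0 unfolding \<rho>_def d_def [symmetric]
      by (simp add: divide_simps) algebra
    have "racah_b l + racah_a (Suc l) = racah_base' l * ((1 - q * A * d / C) * (1 - q * A * v\<^sup>2))"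
      unfolding racah_a_next racah_b_prev [OF l] power_Suc v_def [symmetric] d_def [symmetric]
        1 [symmetric]
      by (simp only: distrib_left mult.assoc)
    also have "\<dots> = (1 - q * A * d / C) / ((1 - q * A / C) * (1 - q * d * A)) *
       ((1 - q * A) * racah_weight q (q * A) (q * B) C N l)"
      unfolding W racah_base'_def qpoch_Suc_shift [of q "q * A / C"]
        qpoch_Suc_shift [of q "q * q ^ N * A"]
      unfolding v_def [symmetric] d_def [symmetric] by (simp add: mult_ac)
    finally show "racah_b l + racah_a (Suc l) = (1 - q * A) * (1 - q * A * q ^ N / C) /
        ((1 - q * A / C) * (1 - q * q ^ N * A)) * racah_weight q (q * A) (q * B) C N l"
      unfolding d_def by simp
  next
    obtain M where M: "N = Suc M"
      using N by (cases N) auto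
    have "q * A * d / C \<noteq> 1"
      using assms ABC_nonzero d unfolding C_ratio d_def [symmetric] by (simp add: field_simps)
    moreover have "(1 - q * A / C) * qpoch q (q * (q * A / C)) N
      = qpoch q (q * A / C) N * (1 - q * A * d / C)"
      using qpoch_shift_mult [of "q * A / C" q N] by (simp add: d_def)
    ultimately have 1: "1 / qpoch q (q * A / C) N = (1 - q * A * d / C) / (1 - q * A / C) /
        qpoch q (q * (q * A / C)) N" "1 - q * A / C \<noteq> 0"
      using lower_nonzero(2) [of N] by (auto simp: divide_simps mult_ac)
    have W: "racah_weight q (q * A) (q * B) C N N = 
      qpoch q (q * (q * A)) M * qpoch q (q * B) N * qpoch q C N * qpoch q (1 / q ^ N) N /
        (qpoch q q N * qpoch q (q * A / B) N * qpoch q (q * (q * A / C)) N *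
          qpoch q (q * (q * q ^ N * A)) M) * \<rho> ^ N"
      unfolding racah_weight_def s using M by simp
    have 2: "qpoch q (q * A) N = (1 - q * A) * qpoch q (q * (q * A)) M"
      "qpoch q (q * q ^ N * A) N = (1 - q * d * A) * qpoch q (q * (q * q ^ N * A)) M"
      unfolding d_def by (simp_all only: M qpoch_Suc_shift)
    have "racah_b N = 1 / qpoch q (q * A / C) N * (qpoch q (q * A) N * qpoch q (q * B) N *
     qpoch q C N * qpoch q (1 / q ^ N) N /
     (qpoch q (q * A / B) N * qpoch q (q * q ^ N * A) N * qpoch q q N)
     * \<rho> ^ N)"
      unfolding racah_b_def by (simp add: mult_ac)
    also have "\<dots> = K * racah_weight q (q * A) (q * B) C N N"
      unfolding 1(1) 2 W K_def by (simp add: mult_ac)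
    finally show "racah_b N = (1 - q * A) * (1 - q * A * q ^ N / C) /
        ((1 - q * A / C) * (1 - q * q ^ N * A)) * racah_weight q (q * A) (q * B) C N N"
      unfolding d_def K_def .
  }
qed

subsection \<open>Orthogonality relations\<close>

abbreviation "form \<equiv> racah_form N q t1 t2 t3 t4"

section \<open>Bilinearity of the form\<close>

lemma racah_sum_cong:
  assumes "\<And>x. x \<noteq> 0 \<Longrightarrow> F x = G x"
  shows "racah_sum F = racah_sum G"
  unfolding racah_sum_def using assms t_nonzero q0 by simp

lemma form_commute: "form f g = form g f"
  by (simp only: racah_form_eq mult.commute)

lemma form_add_right: "form f (g + g') = form f g + form f g'"
  by (simp add: racah_form_eq racah_sum_def distrib_left sum.distrib)

lemma form_scaleR_right: "form f (c *\<^sub>R g) = c * form f g"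
  by (simp add: racah_form_eq racah_sum_def distrib_left sum_distrib_left mult_ac)

lemma form_diff_right: "form f (g - g') = form f g - form f g'"
  using form_add_right [of f "g - g'" g'] by simp

lemma form_0_right: "form f 0 = 0"
  using form_scaleR_right [of f 0 0] by simp

lemma form_add_left: "form (f + f') g = form f g + form f' g"
  by (simp only: form_commute [of _ g] form_add_right)

lemma form_scaleR_left: "form (c *\<^sub>R f) g = c * form f g"
  by (simp only: form_commute [of _ g] form_scaleR_right)

lemma form_span:
  assumes "\<And>s. s \<in> S \<Longrightarrow> form f s = 0" and "g \<in> span S"
  shows "form f g = 0"
  using assms(2) by (induction rule: span_induct_alt)
    (simp_all add: form_0_right form_add_right form_scaleR_right assms(1))

text \<open>Invariant test elements: \<open>e0\<close> and \<open>e2\<close> are unchanged by z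
  \<mapsto> 1/z, \<open>e1\<close> by z \<mapsto> q/z.\<close>

abbreviation "e0 \<equiv> qpoch_pair q t1 t1"
abbreviation "e1 \<equiv> qpoch_pair q t1 (q * t1)"
abbreviation "e2 \<equiv> qpoch_pair q (q * t1) (q * t1)"
abbreviation "R \<equiv> aw_R q t1 t2 t3 t4"
abbreviation "S \<equiv> aw_S q t1 t2 t3 t4"
abbreviation "T \<equiv> aw_T q t1 t2 t3 t4"
abbreviation "U \<equiv> aw_U q t1 t2 t3 t4"

definition hL :: laurent where "hL = zinv * (1 - t1 *\<^sub>R zvar) * (1 - t2 *\<^sub>R zvar)"
definition h2L :: laurent where "h2L = zvar * (1 - t3 *\<^sub>R zinv) * (1 - t4 *\<^sub>R zinv)"

text \<open>The invariant cofactors of the multipliers in U_(m+1) and S_(m+1), indexed by their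
  degree m.\<close>

definition U' :: "nat \<Rightarrow> laurent" where "U' m = aw_R q (q * t1) (q * t2) t3 t4 m"
definition S' :: "nat \<Rightarrow> laurent" where
  "S' m = phi43 q (q powi (- int m)) (P * q ^ Suc m) (t1 *\<^sub>R zvar) ((q * t1) *\<^sub>R zinv)
    (q * B) (q * C) (q * (t1 * t4))"

lemma U_eq: "U (Suc m) = hL * U' m"
  by (simp add: aw_U_def hL_def U'_def)

lemma S_eq: "S (Suc m) = h2L * S' m"
  by (simp add: aw_S_def h2L_def S'_def B_def C_def mult.assoc)

lemma eval_hL: "x \<noteq> 0 \<Longrightarrow> laurent_eval hL x = h x"
  and eval_h2L: "x \<noteq> 0 \<Longrightarrow> laurent_eval h2L x = h2 x"
  by (simp_all add: hL_def h2L_def h_def h2_def)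

section \<open>Values of the families at the nodes\<close>

lemma node_nonzero: "t1 * q ^ k \<noteq> 0" "1 / (t1 * q ^ k) \<noteq> 0"
  using t_nonzero q0 by simp_all

lemma eval_e0:
  "laurent_eval (e0 j) (t1 * q ^ k) = racah_e q A j k"
  "laurent_eval (e0 j) (1 / (t1 * q ^ k)) = racah_e q A j k"
  using t_nonzero q0
  by (auto intro!: laurent_eval_qpoch_pair simp: A_def power2_eq_square)

lemma eval_e1:
  "laurent_eval (e1 j) (t1 * q ^ Suc l) = racah_e q (q * A) j l"
  "laurent_eval (e1 j) (1 / (t1 * q ^ l)) = racah_e q (q * A) j l"
  using t_nonzero q0
  by (auto intro!: laurent_eval_qpoch_pair simp: A_def power2_eq_square)

lemma eval_e2:
  "laurent_eval (e2 j) (t1 * q ^ Suc l) = racah_e q (q * (q * A)) j l"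
  "laurent_eval (e2 j) (1 / (t1 * q ^ Suc l)) = racah_e q (q * (q * A)) j l"
  using t_nonzero q0
  by (auto intro!: laurent_eval_qpoch_pair simp: A_def power2_eq_square)

lemma powi_pred: "q powi (int n - 1) = q ^ n / q"
  using q0 by (simp add: power_int_diff)

lemma N_pred: "q ^ N = q * q ^ (N - 1)"
  using N by (cases N) auto

lemma R_eq: "R n = phi43 q (q powi (- int n)) (B * C / (A * q ^ N) * q ^ n / q)
    (t1 *\<^sub>R zvar) (t1 *\<^sub>R zinv) B C (1 / q ^ N)"
  unfolding aw_R_def P_eq powi_pred t14 unfolding B_def [symmetric] C_def [symmetric] by simp

lemma T_eq: "T n = phi43 q (q powi (- int n)) (q * B * C / (q * A * q ^ N) * q ^ n / q)
    (t1 *\<^sub>R zvar) ((q * t1) *\<^sub>R zinv) (q * B) C (1 / q ^ N)"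
proof -
  have 1: "q * t1 * t2 = q * B" by (simp add: B_def)
  show ?thesis
    unfolding aw_T_def P_eq powi_pred t14 1 C_def [symmetric] using q0 by simp
qed

text \<open>Multiplying t1 and t2 by q turns A, B, C, q^-N into q^2 A, q^2 B, q C, q^(1-N); the last
  one accounts for N - 1.\<close>

lemma U'_eq: "U' m = phi43 q (q powi (- int m))
    (q * (q * B) * (q * C) / (q * (q * A) * q ^ (N - 1)) * q ^ m / q)
    ((q * t1) *\<^sub>R zvar) ((q * t1) *\<^sub>R zinv) (q * (q * B)) (q * C) (1 / q ^ (N - 1))"
proof -
  have 1: "q * t1 * (q * t2) = q * (q * B)" "q * t1 * t3 = q * C" "q * t1 * t4 = 1 / q ^ (N - 1)"
    using t14 q0 by (simp_all add: B_def C_def mult.assoc N_pred)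
  have "q * t1 * (q * t2) * t3 * t4 = q * q * P" by simp
  also have "\<dots> = q * (q * B) * (q * C) / (q * (q * A) * q ^ (N - 1))"
    unfolding P_eq using q0 by (simp add: N_pred)
  finally have 2: "q * t1 * (q * t2) * t3 * t4 = q * (q * B) * (q * C) / (q * (q * A) * q ^ (N - 1))" .
  show ?thesis
    unfolding U'_def aw_R_def powi_pred 2 unfolding 1 by simp
qed

lemma S'_eq: "S' m = phi43 q (q powi (- int m))
    (q * B * (q * C) / (q * A * q ^ (N - 1)) * q ^ m / q)
    (t1 *\<^sub>R zvar) ((q * t1) *\<^sub>R zinv) (q * B) (q * C) (1 / q ^ (N - 1))"
proof -
  have 1: "q * (t1 * t4) = 1 / q ^ (N - 1)"
    using q0 unfolding t14 by (simp add: N_pred)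
  have 2: "P * q ^ Suc m = q * B * (q * C) / (q * A * q ^ (N - 1)) * q ^ m / q"
    unfolding P_eq using q0 by (simp add: N_pred)
  show ?thesis
    unfolding S'_def 1 2 ..
qed

lemma eval_R:
  "laurent_eval (R n) (t1 * q ^ k) = racah_phi q A B C N n k"
  "laurent_eval (R n) (1 / (t1 * q ^ k)) = racah_phi q A B C N n k"
  unfolding R_eq using t_nonzero q0
  by (auto intro!: laurent_eval_phi43 simp: A_def power2_eq_square)

lemma eval_T:
  "laurent_eval (T n) (t1 * q ^ Suc l) = racah_phi q (q * A) (q * B) C N n l"
  "laurent_eval (T n) (1 / (t1 * q ^ l)) = racah_phi q (q * A) (q * B) C N n l"
  unfolding T_eq using t_nonzero q0
  by (auto intro!: laurent_eval_phi43 simp: A_def power2_eq_square)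

lemma eval_U':
  "laurent_eval (U' m) (t1 * q ^ Suc l) = racah_phi q (q * (q * A)) (q * (q * B)) (q * C) (N - 1) m l"
  "laurent_eval (U' m) (1 / (t1 * q ^ Suc l)) = racah_phi q (q * (q * A)) (q * (q * B)) (q * C) (N - 1) m l"
  unfolding U'_eq using t_nonzero q0
  by (auto intro!: laurent_eval_phi43 simp: A_def power2_eq_square)

lemma eval_S':
  "laurent_eval (S' m) (t1 * q ^ Suc l) = racah_phi q (q * A) (q * B) (q * C) (N - 1) m l"
  "laurent_eval (S' m) (1 / (t1 * q ^ l)) = racah_phi q (q * A) (q * B) (q * C) (N - 1) m l"
  unfolding S'_eq using t_nonzero q0
  by (auto intro!: laurent_eval_phi43 simp: A_def power2_eq_square)

section \<open>Admissibility of the four sets of q-Racah parameters\<close>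

lemma params_R: "racah_params q A B C N"
  using q ABC_nonzero upper_nonzero(1)[of N] upper_nonzero(2)[of N] lower_nonzero(1,2) [of N]
    lower_nonzero(3) [of "N - 1"]
  by unfold_locales auto

lemma params_S: "racah_params q (q * A) (q * B) (q * C) (N - 1)"
proof -
  have s: "q * (q * A) / (q * B) = q * A / B" "q * (q * A) / (q * C) = q * A / C"
    "q * q ^ (N - 1) * (q * A) = q * q ^ N * A"
    using q0 N_pred by simp_all
  have "qpoch q (q * B) (N - 1) \<noteq> 0" "qpoch q (q * C) (N - 1) \<noteq> 0"
    using upper_nonzero [of N] qpoch_nonzero_shift [of q _ N "N - 1"] N by auto
  then show ?thesis
    unfolding racah_params_def s
    using q ABC_nonzero lower_nonzero [of "N - 1"] lower_nonzero(3) [of "N - 1 - 1"] by auto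
qed

lemma params_U: "racah_params q (q * (q * A)) (q * (q * B)) (q * C) (N - 1)"
proof -
  have s: "q * (q * (q * A)) / (q * (q * B)) = q * A / B"
    "q * (q * (q * A)) / (q * C) = q * (q * A / C)"
    "q * q ^ (N - 1) * (q * (q * A)) = q * (q * q ^ N * A)"
    using q0 N_pred by simp_all
  have "qpoch q (q * B) N \<noteq> 0"
    using upper_nonzero by (intro qpoch_nonzero_shift [of _ _ "Suc N"]) auto
  then have "qpoch q (q * (q * B)) (N - 1) \<noteq> 0" "qpoch q (q * C) (N - 1) \<noteq> 0"
    "qpoch q (q * (q * A / C)) (N - 1) \<noteq> 0" "qpoch q (q * (q * q ^ N * A)) (N - 1 - 1) \<noteq> 0"
    using upper_nonzero(2) [of N] lower_nonzero(2,3) [of N] N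
      qpoch_nonzero_shift [of q _ N "N - 1"] qpoch_nonzero_shift [of q _ N "N - 1 - 1"]
    by (auto simp del: times_divide_eq_right)
  then show ?thesis
    unfolding racah_params_def s
    using q ABC_nonzero lower_nonzero [of "N - 1"] by auto
qed

lemma params_T:
  assumes "t3 * t4 \<noteq> q"
  shows "racah_params q (q * A) (q * B) C N"
proof -
  have s: "q * (q * A) / (q * B) = q * A / B"
    "q * (q * A) / C = q * (q * A / C)"
    "q * q ^ N * (q * A) = q * (q * q ^ N * A)"
    using q0 by simp_all
  have 1: "qpoch q (q * B) N \<noteq> 0"
    using upper_nonzero by (intro qpoch_nonzero_shift [of _ _ "Suc N"]) auto
  have "q * A * q ^ N / C \<noteq> 1"
    using assms ABC_nonzero q0 unfolding C_ratio by (simp add: field_simps)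
  then have 2: "qpoch q (q * (q * A / C)) N \<noteq> 0"
    using qpoch_shift_mult [of "q * A / C" q N] lower_nonzero(2) [of N] by auto
  have 3: "qpoch q (q * (q * q ^ N * A)) (N - 1) \<noteq> 0"
    using lower_nonzero(3) [of N] N by (intro qpoch_nonzero_shift [of _ _ N]) auto
  show ?thesis
    unfolding racah_params_def s
    using q ABC_nonzero lower_nonzero [of N] upper_nonzero(2) [of N] 1 2 3 by auto
qed

text \<open>Both arguments are invariant under inversion, so the form folds into the q-Racah sum;
  the unpaired node 1 / t1 gives its term k = 0.\<close>

lemma R_perp_e0:
  assumes "j < n" "n \<le> N"
  shows "form (R n) (e0 j) = 0"
proof -
  let ?f = "\<lambda>k. racah_phi q A B C N n k * racah_e q A j k"
  have "form (R n) (e0 j) = (\<Sum>l<N. racah_a (Suc l) * ?f (Suc l)) + (\<Sum>k\<le>N. racah_b k * ?f k)"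
    unfolding racah_form_eq racah_sum_reindex eval_R eval_e0 ..
  also have "(\<Sum>k\<le>N. racah_b k * ?f k) = racah_b 0 * ?f 0 + (\<Sum>l<N. racah_b (Suc l) * ?f (Suc l))"
    by (rule sum.atMost_shift)
  also have "(\<Sum>l<N. racah_a (Suc l) * ?f (Suc l)) + (racah_b 0 * ?f 0 + (\<Sum>l<N. racah_b (Suc l) * ?f (Suc l)))
    = racah_b 0 * ?f 0 + (\<Sum>l<N. (racah_a (Suc l) + racah_b (Suc l)) * ?f (Suc l))"
    by (simp add: distrib_right sum.distrib)
  also have "\<dots> = racah_weight q A B C N 0 * ?f 0 + (\<Sum>l<N. racah_weight q A B C N (Suc l) * ?f (Suc l))"
    by (simp add: weight_R racah_b_def [of 0] racah_weight_def [of _ _ _ _ _ 0])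
  also have "\<dots> = (\<Sum>k\<le>N. racah_weight q A B C N k * ?f k)"
    by (rule sum.atMost_shift [symmetric])
  also have "\<dots> = 0"
    using racah_orthogonality [OF params_R assms] by (simp only: mult.assoc)
  finally show ?thesis .
qed

lemma form_hL:
  "form (hL * f) g = (\<Sum>l<N. racah_a (Suc l) * h (t1 * q ^ Suc l) *
     (laurent_eval f (t1 * q ^ Suc l) * laurent_eval g (t1 * q ^ Suc l) -
      laurent_eval f (1 / (t1 * q ^ Suc l)) * laurent_eval g (1 / (t1 * q ^ Suc l))))"
proof -
  have "form (hL * f) g = racah_sum (\<lambda>x. h x * (laurent_eval f x * laurent_eval g x))"
    unfolding racah_form_eq by (rule racah_sum_cong) (simp add: eval_hL)
  then show ?thesis
    unfolding racah_sum_h .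
qed

lemma form_h2L:
  "form (h2L * f) g = (\<Sum>l<N. racah_a (Suc l) * h2 (t1 * q ^ Suc l) *
     (laurent_eval f (t1 * q ^ Suc l) * laurent_eval g (t1 * q ^ Suc l) -
      laurent_eval f (1 / (t1 * q ^ l)) * laurent_eval g (1 / (t1 * q ^ l))))"
proof -
  have "form (h2L * f) g = racah_sum (\<lambda>x. h2 x * (laurent_eval f x * laurent_eval g x))"
    unfolding racah_form_eq by (rule racah_sum_cong) (simp add: eval_h2L)
  then show ?thesis
    unfolding racah_sum_h2 .
qed

text \<open>\<open>R n\<close> and the cofactor of \<open>hL\<close> are invariant under inversion,
  so each difference in \<open>form_hL\<close> is zero. The next five lemmas argue likewise, those
  on S and T with \<open>h2L\<close> and z \<mapsto> q/z.\<close>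

lemma R_perp_hL_e2: "form (R n) (hL * e2 j) = 0"
  unfolding form_commute [of "R n"] form_hL eval_R eval_e2 by simp

lemma R_perp_U: "form (R n) (U (Suc m)) = 0"
  unfolding form_commute [of "R n"] U_eq form_hL eval_R eval_U' by simp

lemma U_perp_e0: "form (U (Suc m)) (e0 j) = 0"
  unfolding U_eq form_hL eval_U' eval_e0 by simp

lemma S_perp_e1: "form (S (Suc m)) (e1 j) = 0"
  unfolding S_eq form_h2L eval_S' eval_e1 by simp

lemma T_perp_S: "form (T n) (S (Suc m)) = 0"
  unfolding form_commute [of "T n"] S_eq form_h2L eval_T eval_S' by simp

lemma T_perp_h2L_e1: "form (T n) (h2L * e1 j) = 0"
  unfolding form_commute [of "T n"] form_h2L eval_T eval_e1 by simp

text \<open>The invariant values factor out of each difference, and z leaves the x - 1/x of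
  \<open>weight_U\<close>.\<close>

lemma U_perp_z_e2:
  assumes "j < m" "m < N"
  shows "form (U (Suc m)) (zvar * e2 j) = 0"
proof -
  obtain K where K: "\<And>l. l < N \<Longrightarrow> racah_a (Suc l) * h (t1 * q ^ Suc l) *
      (t1 * q ^ Suc l - 1 / (t1 * q ^ Suc l))
     = K * racah_weight q (q * (q * A)) (q * (q * B)) (q * C) (N - 1) l"
    using weight_U by blast
  let ?f = "\<lambda>k. racah_phi q (q * (q * A)) (q * (q * B)) (q * C) (N - 1) m k *
     racah_e q (q * (q * A)) j k"
  have "form (U (Suc m)) (zvar * e2 j) = (\<Sum>l<N. racah_a (Suc l) * h (t1 * q ^ Suc l) *
      (t1 * q ^ Suc l - 1 / (t1 * q ^ Suc l)) * ?f l)"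
    unfolding U_eq form_hL eval_U'
    by (simp only: laurent_eval_mult [OF node_nonzero(1)] laurent_eval_mult [OF node_nonzero(2)]
      eval_e2 laurent_eval_zvar) (simp only: algebra_simps)
  also have "\<dots> = (\<Sum>l<N. K * (racah_weight q (q * (q * A)) (q * (q * B)) (q * C) (N - 1) l * ?f l))"
    by (intro sum.cong refl) (simp only: K lessThan_iff mult.assoc [of K])
  also have "\<dots> = K * (\<Sum>l\<le>N - 1. racah_weight q (q * (q * A)) (q * (q * B)) (q * C) (N - 1) l * ?f l)"
    unfolding sum_distrib_left using N by (cases N) (simp_all add: lessThan_Suc_atMost)
  also have "\<dots> = 0"
    using racah_orthogonality [OF params_U, of j m] assms by (simp add: mult.assoc)
  finally show ?thesis .
qed

lemma S_perp_z_e1: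
  assumes "j < m" "m < N"
  shows "form (S (Suc m)) (zvar * e1 j) = 0"
proof -
  obtain K where K: "\<And>l. l < N \<Longrightarrow> racah_a (Suc l) * h2 (t1 * q ^ Suc l) *
      (t1 * q ^ Suc l - 1 / (t1 * q ^ l))
     = K * racah_weight q (q * A) (q * B) (q * C) (N - 1) l"
    using weight_S by blast
  let ?f = "\<lambda>k. racah_phi q (q * A) (q * B) (q * C) (N - 1) m k * racah_e q (q * A) j k"
  have "form (S (Suc m)) (zvar * e1 j) = (\<Sum>l<N. racah_a (Suc l) * h2 (t1 * q ^ Suc l) *
      (t1 * q ^ Suc l - 1 / (t1 * q ^ l)) * ?f l)"
    unfolding S_eq form_h2L eval_S'
    by (simp only: laurent_eval_mult [OF node_nonzero(1)] laurent_eval_mult [OF node_nonzero(2)]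
      eval_e1 laurent_eval_zvar) (simp only: algebra_simps)
  also have "\<dots> = (\<Sum>l<N. K * (racah_weight q (q * A) (q * B) (q * C) (N - 1) l * ?f l))"
    by (intro sum.cong refl) (simp only: K lessThan_iff mult.assoc [of K])
  also have "\<dots> = K * (\<Sum>l\<le>N - 1. racah_weight q (q * A) (q * B) (q * C) (N - 1) l * ?f l)"
    unfolding sum_distrib_left using N by (cases N) (simp_all add: lessThan_Suc_atMost)
  also have "\<dots> = 0"
    using racah_orthogonality [OF params_S, of j m] assms by (simp add: mult.assoc)
  finally show ?thesis .
qed

text \<open>Here the form is folded by z \<mapsto> q/z, and the unpaired node gives the term k =
  N.\<close>

lemma T_perp_e1:
  assumes "t3 * t4 \<noteq> q" "j < n" "n \<le> N"
  shows "form (T n) (e1 j) = 0"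
proof -
  obtain K where K: "\<And>l. l < N \<Longrightarrow> racah_b l + racah_a (Suc l) = K * racah_weight q (q * A) (q * B) C N l"
    and KN: "racah_b N = K * racah_weight q (q * A) (q * B) C N N"
    using weight_T [OF assms(1)] by blast
  let ?f = "\<lambda>k. racah_phi q (q * A) (q * B) C N n k * racah_e q (q * A) j k"
  have "form (T n) (e1 j) = (\<Sum>l<N. racah_a (Suc l) * ?f l) + (\<Sum>k\<le>N. racah_b k * ?f k)"
    unfolding racah_form_eq racah_sum_reindex eval_T eval_e1 ..
  also have "\<dots> = (\<Sum>l<N. (racah_b l + racah_a (Suc l)) * ?f l) + racah_b N * ?f N"
    by (simp add: distrib_right sum.distrib flip: lessThan_Suc_atMost)
  also have "\<dots> = (\<Sum>l<N. K * (racah_weight q (q * A) (q * B) C N l * ?f l))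
      + K * (racah_weight q (q * A) (q * B) C N N * ?f N)"
    unfolding KN by (simp add: K mult.assoc)
  also have "\<dots> = K * (\<Sum>l\<le>N. racah_weight q (q * A) (q * B) C N l * ?f l)"
    by (simp add: sum_distrib_left distrib_left flip: lessThan_Suc_atMost)
  also have "\<dots> = 0"
    using racah_orthogonality [OF params_T [OF assms(1)] assms(2,3)] by (simp add: mult.assoc)
  finally show ?thesis .
qed

subsection \<open>Leading coefficients and bases\<close>

abbreviation "\<pi> \<equiv> lead_const q"

lemma \<pi>_nonzero: "\<pi> t1 n \<noteq> 0"
  using t_nonzero q0 by (intro lead_const_nonzero)

text \<open>\<open>hL\<close> expands to 1/z - (t1 + t2) + t1 t2 z.\<close>

lemma lead_hL: "laurent_lead n a b f \<Longrightarrow> laurent_lead (Suc n) (B * a) b (hL * f)"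
proof -
  assume f: "laurent_lead n a b f"
  have "hL = (- (t1 + t2)) *\<^sub>R 1 + B *\<^sub>R zvar + 1 *\<^sub>R zinv"
  proof -
    have "zinv * zvar = 1"
      using zvar_zinv by (simp add: mult.commute)
    then have "zinv * (1 - a *\<^sub>R zvar) * (1 - b *\<^sub>R zvar) = zinv - (a + b) *\<^sub>R 1 + (a * b) *\<^sub>R zvar" for a b
      by (simp add: algebra_simps flip: mult.assoc)
    then show ?thesis
      by (simp add: hL_def B_def algebra_simps)
  qed
  then show ?thesis
    using laurent_lead_mult [OF f, of B 1 "- (t1 + t2)"] by simp
qed

lemma lead_h2L: "laurent_lead n a b f \<Longrightarrow> laurent_lead (Suc n) a (t3 * t4 * b) (h2L * f)"
proof -
  assume f: "laurent_lead n a b f"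
  have "h2L = (- (t3 + t4)) *\<^sub>R 1 + 1 *\<^sub>R zvar + (t3 * t4) *\<^sub>R zinv"
  proof -
    have "zvar * (1 - a *\<^sub>R zinv) * (1 - b *\<^sub>R zinv) = zvar - (a + b) *\<^sub>R 1 + (a * b) *\<^sub>R zinv" for a b
      using zvar_zinv by (simp add: algebra_simps flip: mult.assoc)
    then show ?thesis
      by (simp add: h2L_def algebra_simps)
  qed
  then show ?thesis
    using laurent_lead_mult [OF f, of 1 "t3 * t4" "- (t3 + t4)"] by simp
qed

lemma lead_z: "laurent_lead n a b f \<Longrightarrow> laurent_lead (Suc n) a 0 (zvar * f)"
  using laurent_lead_mult [of n a b f 1 0 0] by simp

lemma lead_e0: "laurent_lead n (\<pi> t1 n) (\<pi> t1 n) (e0 n)"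
  and lead_e1: "laurent_lead n (\<pi> t1 n) (q ^ n * \<pi> t1 n) (e1 n)"
  and lead_e2: "laurent_lead n (q ^ n * \<pi> t1 n) (q ^ n * \<pi> t1 n) (e2 n)"
  using laurent_lead_qpoch_pair [of n q t1 t1] laurent_lead_qpoch_pair [of n q t1 "q * t1"]
    laurent_lead_qpoch_pair [of n q "q * t1" "q * t1"]
  by (simp_all add: lead_const_mult)

lemma B_neq_1: "B \<noteq> 1"
  using upper_nonzero(1) [of "Suc 0"] by (simp add: qpoch_Suc)

lemma C_neq_1: "C \<noteq> 1"
  using upper_nonzero(2) [of "Suc 0"] N by (simp add: qpoch_Suc)

lemma D_neq_1: "1 / q ^ N \<noteq> 1"
  using qpoch_inverse_power_nonzero [OF q, of "Suc 0" N] N by (simp add: qpoch_Suc)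

abbreviation "c \<equiv> aw_c t1 t2 t3 t4"

lemma c_nonzero: "c \<noteq> 0"
  unfolding aw_c_def t14 using B_neq_1 C_neq_1 D_neq_1 by (simp add: B_def C_def)

text \<open>This and the next three lemmas provide the spanning sets of V_m against which R, U, S
  and T, in this order, are tested. Here the determinant is nonzero because t1 t2 differs from
  1.\<close>

lemma span_e0_hL:
  "laurent_space m \<subseteq> span (e0 ` {0..m} \<union> (\<lambda>n. hL * e2 (n - 1)) ` {1..m})"
proof (rule laurent_space_subset_span)
  fix n :: nat assume "1 \<le> n"
  then obtain k where n: "n = Suc k" by (cases n) auto
  have "\<pi> t1 n * (q ^ k * \<pi> t1 k) \<noteq> \<pi> t1 n * (B * (q ^ k * \<pi> t1 k))"
    using \<pi>_nonzero q0 B_neq_1 by simp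
  then show "\<exists>a b c d. laurent_lead n a b (e0 n) \<and> laurent_lead n c d (hL * e2 (n - 1)) \<and> a * d \<noteq> b * c"
    using lead_e0 [of n] lead_hL [OF lead_e2, of k] n diff_Suc_1 by metis
qed (use lead_e0 [of 0] \<pi>_nonzero in auto)

lemma span_e0_z:
  "laurent_space m \<subseteq> span (e0 ` {0..m} \<union> (\<lambda>n. zvar * e2 (n - 1)) ` {1..m})"
proof (rule laurent_space_subset_span)
  fix n :: nat assume "1 \<le> n"
  then obtain k where n: "n = Suc k" by (cases n) auto
  have "\<pi> t1 n * 0 \<noteq> \<pi> t1 n * (q ^ k * \<pi> t1 k)"
    using \<pi>_nonzero q0 by simp
  then show "\<exists>a b c d. laurent_lead n a b (e0 n) \<and> laurent_lead n c d (zvar * e2 (n - 1)) \<and> a * d \<noteq> b * c"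
    using lead_e0 [of n] lead_z [OF lead_e2, of k] n diff_Suc_1 by metis
qed (use lead_e0 [of 0] \<pi>_nonzero in auto)

lemma span_e1_z:
  "laurent_space m \<subseteq> span (e1 ` {0..m} \<union> (\<lambda>n. zvar * e1 (n - 1)) ` {1..m})"
proof (rule laurent_space_subset_span)
  fix n :: nat assume "1 \<le> n"
  then obtain k where n: "n = Suc k" by (cases n) auto
  have "\<pi> t1 n * 0 \<noteq> q ^ n * \<pi> t1 n * \<pi> t1 k"
    using \<pi>_nonzero q0 by simp
  then show "\<exists>a b c d. laurent_lead n a b (e1 n) \<and> laurent_lead n c d (zvar * e1 (n - 1)) \<and> a * d \<noteq> b * c"
    using lead_e1 [of n] lead_z [OF lead_e1, of k] n diff_Suc_1 by metis
qed (use lead_e1 [of 0] \<pi>_nonzero in auto)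

text \<open>The outer coefficients have ratio q^n for \<open>e1 n\<close> and t3 t4 q^(n-1) for the
  other element, so independence requires t3 t4 to differ from q.\<close>

lemma span_e1_h2L:
  assumes "t3 * t4 \<noteq> q"
  shows "laurent_space m \<subseteq> span (e1 ` {0..m} \<union> (\<lambda>n. h2L * e1 (n - 1)) ` {1..m})"
proof (rule laurent_space_subset_span)
  fix n :: nat assume "1 \<le> n"
  then obtain k where n: "n = Suc k" by (cases n) auto
  have "\<pi> t1 n * (t3 * t4 * (q ^ k * \<pi> t1 k)) \<noteq> q ^ n * \<pi> t1 n * \<pi> t1 k"
    using \<pi>_nonzero q0 assms n by simp
  then show "\<exists>a b c d. laurent_lead n a b (e1 n) \<and> laurent_lead n c d (h2L * e1 (n - 1)) \<and> a * d \<noteq> b * c"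
    using lead_e1 [of n] lead_h2L [OF lead_e1, of k] n diff_Suc_1 by metis
qed (use lead_e1 [of 0] \<pi>_nonzero in auto)

lemma R_perp:
  assumes "m < N" "v \<in> laurent_space m"
  shows "form (R (Suc m)) v = 0"
  by (rule form_span [OF _ subsetD [OF span_e0_hL assms(2)]])
    (use assms R_perp_e0 [of _ "Suc m"] R_perp_hL_e2 in auto)

lemma U_perp:
  assumes "m < N" "v \<in> laurent_space m"
  shows "form (U (Suc m)) v = 0"
  by (rule form_span [OF _ subsetD [OF span_e0_z assms(2)]])
    (use assms U_perp_e0 U_perp_z_e2 in auto)

lemma S_perp:
  assumes "m < N" "v \<in> laurent_space m"
  shows "form (S (Suc m)) v = 0"
  by (rule form_span [OF _ subsetD [OF span_e1_z assms(2)]])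
    (use assms S_perp_e1 S_perp_z_e1 in auto)

lemma T_perp:
  assumes "t3 * t4 \<noteq> q" "m < N" "v \<in> laurent_space m"
  shows "form (T (Suc m)) v = 0"
  by (rule form_span [OF _ subsetD [OF span_e1_h2L [OF assms(1)] assms(3)]])
    (use assms T_perp_e1 [of _ "Suc m"] T_perp_h2L_e1 in auto)

text \<open>The exponents j, ..., j + k - 1 stay in the range covered by \<open>nd\<close>.\<close>

lemma P_nonzero:
  assumes "j + k \<le> 2 * N - 1"
  shows "qpoch q (P * q ^ j) k \<noteq> 0"
proof
  assume "qpoch q (P * q ^ j) k = 0"
  then obtain i where i: "i < k" "P * q ^ (j + i) = 1"
    by (auto simp: qpoch_real_eq_0_iff power_add mult_ac)
  with assms nd show False
    by auto
qed

lemma P_neq_1: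
  assumes "m < N"
  shows "P * q ^ m \<noteq> 1"
  using P_nonzero [of m "Suc 0"] assms by (simp add: qpoch_Suc)

lemma denominators:
  assumes "k \<le> N"
  shows "qpoch q q k \<noteq> 0" "qpoch q (t1 * t2) k \<noteq> 0" "qpoch q (t1 * t3) k \<noteq> 0"
    "qpoch q (t1 * t4) k \<noteq> 0" "qpoch q (q * (t1 * t2)) k \<noteq> 0"
  using qpoch_self_nonzero [OF q, of k] upper_nonzero(1) [of k] upper_nonzero(2) [of k] assms
    qpoch_inverse_power_nonzero [OF q assms] upper_nonzero(1) [of "Suc k"]
    qpoch_nonzero_shift [of q B "Suc k" k]
  unfolding t14 by (simp_all add: B_def C_def)

lemma denominators_shift:
  assumes "k < N"
  shows "qpoch q (q * (t1 * t3)) k \<noteq> 0"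
    "qpoch q (q * (t1 * t4)) k \<noteq> 0" "qpoch q (q * (q * (t1 * t2))) k \<noteq> 0"
  using assms denominators [of "Suc k"] qpoch_nonzero_shift [of q _ "Suc k" k] by simp_all

lemma lead_R:
  assumes "n \<le> N"
  shows "\<exists>r. r \<noteq> 0 \<and> laurent_lead n r r (R n)"
proof -
  define \<kappa> where "\<kappa> = qpoch q (1 / q ^ n) n * qpoch q (P * q powi (int n - 1)) n /
     (qpoch q q n * qpoch q (t1 * t2) n * qpoch q (t1 * t3) n * qpoch q (t1 * t4) n) * q ^ n"
  have 1: "laurent_lead n (\<kappa> * \<pi> t1 n) (\<kappa> * \<pi> t1 n) (R n)"
    unfolding aw_R_def \<kappa>_def by (rule laurent_lead_phi43 [OF q0])
  have "qpoch q (P * q powi (int n - 1)) n \<noteq> 0"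
  proof (cases n)
    case (Suc m)
    then show ?thesis
      using P_nonzero [of m n] assms by simp
  qed simp
  then have "\<kappa> \<noteq> 0"
    using denominators [OF assms] qpoch_inverse_power_nonzero [OF q, of n n] q0
    by (simp add: \<kappa>_def)
  then show ?thesis
    using 1 \<pi>_nonzero by (metis mult_eq_0_iff)
qed

lemma lead_T:
  assumes "n \<le> N"
  shows "\<exists>r. r \<noteq> 0 \<and> laurent_lead n r (q ^ n * r) (T n)"
proof -
  define \<kappa> where "\<kappa> = qpoch q (1 / q ^ n) n * qpoch q (P * q powi (int n - 1)) n /
     (qpoch q q n * qpoch q (q * t1 * t2) n * qpoch q (t1 * t3) n * qpoch q (t1 * t4) n) * q ^ n"
  have 1: "laurent_lead n (\<kappa> * \<pi> t1 n) (\<kappa> * \<pi> (q * t1) n) (T n)"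
    unfolding aw_T_def \<kappa>_def by (rule laurent_lead_phi43 [OF q0])
  have "qpoch q (P * q powi (int n - 1)) n \<noteq> 0"
  proof (cases n)
    case (Suc m)
    then show ?thesis
      using P_nonzero [of m n] assms by simp
  qed simp
  then have "\<kappa> \<noteq> 0"
    using denominators [OF assms] qpoch_inverse_power_nonzero [OF q, of n n] q0
    by (simp add: \<kappa>_def mult.assoc)
  then have "\<kappa> * \<pi> t1 n \<noteq> 0"
    using \<pi>_nonzero by simp
  moreover have "\<kappa> * \<pi> (q * t1) n = q ^ n * (\<kappa> * \<pi> t1 n)"
    by (simp add: lead_const_mult)
  ultimately show ?thesis
    using 1 by metis
qed

lemma lead_U:
  assumes "m < N"
  shows "\<exists>r. r \<noteq> 0 \<and> laurent_lead (Suc m) (B * r) r (U (Suc m))"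
proof -
  define \<kappa> where "\<kappa> = qpoch q (1 / q ^ m) m * qpoch q (q * t1 * (q * t2) * t3 * t4 * q powi (int m - 1)) m /
     (qpoch q q m * qpoch q (q * t1 * (q * t2)) m * qpoch q (q * t1 * t3) m * qpoch q (q * t1 * t4) m) * q ^ m"
  have 1: "laurent_lead m (\<kappa> * \<pi> (q * t1) m) (\<kappa> * \<pi> (q * t1) m) (U' m)"
    unfolding U'_def aw_R_def \<kappa>_def by (rule laurent_lead_phi43 [OF q0])
  have P: "q * t1 * (q * t2) * t3 * t4 * q powi (int m - 1) = P * q ^ Suc m"
    using q0 by (simp add: powi_pred)
  have "qpoch q (P * q ^ Suc m) m \<noteq> 0"
    using assms by (intro P_nonzero) auto
  then have "\<kappa> \<noteq> 0"
    using denominators [of m] denominators_shift [of m] assms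
      qpoch_inverse_power_nonzero [OF q, of m m] q0
    unfolding \<kappa>_def P by (simp add: mult_ac)
  then have "\<kappa> * \<pi> (q * t1) m \<noteq> 0"
    using \<pi>_nonzero q0 by (simp add: lead_const_mult)
  then show ?thesis
    using lead_hL [OF 1] unfolding U_eq by metis
qed

text \<open>One scalar r normalises both elements, so their outer coefficients can be compared. The
  last coefficient of the series for R_(m+1) is an explicit multiple of that of the series of degree
  m in S_(m+1).\<close>

lemma lead_S_R:
  assumes "m < N"
  shows "\<exists>r. r \<noteq> 0 \<and> laurent_lead (Suc m) r (t3 * t4 * q ^ m * r) (S (Suc m)) \<and>
    laurent_lead (Suc m) (t1 * (1 - P * q ^ m) * r) (t1 * (1 - P * q ^ m) * r)
      (aw_c t1 t2 t3 t4 *\<^sub>R R (Suc m))"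
proof -
  define X Y where "X = qpoch q (1 / q ^ m) m" and "Y = qpoch q (P * q ^ Suc m) m"
  define den where "den = qpoch q q m * qpoch q (q * (t1 * t2)) m *
    qpoch q (q * (t1 * t3)) m * qpoch q (q * (t1 * t4)) m"
  define \<kappa> where "\<kappa> = X * Y / den * q ^ m"
  define r where "r = \<kappa> * \<pi> t1 m"
  have 1: "laurent_lead m (\<kappa> * \<pi> t1 m) (\<kappa> * \<pi> (q * t1) m) (S' m)"
    unfolding S'_def \<kappa>_def X_def Y_def den_def B_def C_def by (rule laurent_lead_phi43 [OF q0])
  have "t3 * t4 * (\<kappa> * \<pi> (q * t1) m) = t3 * t4 * q ^ m * r"
    by (simp add: r_def lead_const_mult)
  with lead_h2L [OF 1] have S: "laurent_lead (Suc m) r (t3 * t4 * q ^ m * r) (S (Suc m))"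
    unfolding S_eq r_def by metis
  have den: "den \<noteq> 0"
    using denominators [of m] denominators_shift [of m] assms by (simp add: den_def)
  have "Y \<noteq> 0"
    unfolding Y_def using assms by (intro P_nonzero) auto
  then have "r \<noteq> 0"
    using den \<pi>_nonzero q0 qpoch_inverse_power_nonzero [OF q, of m m]
    by (simp add: r_def \<kappa>_def X_def)
  define \<kappa>' where "\<kappa>' = qpoch q (1 / q ^ Suc m) (Suc m) * qpoch q (P * q powi (int (Suc m) - 1)) (Suc m) /
     (qpoch q q (Suc m) * qpoch q (t1 * t2) (Suc m) * qpoch q (t1 * t3) (Suc m) *
      qpoch q (t1 * t4) (Suc m)) * q ^ Suc m"
  have 2: "laurent_lead (Suc m) (\<kappa>' * \<pi> t1 (Suc m)) (\<kappa>' * \<pi> t1 (Suc m)) (R (Suc m))"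
    unfolding aw_R_def \<kappa>'_def by (rule laurent_lead_phi43 [OF q0])
  have nz: "1 - q ^ Suc m \<noteq> 0"
    using lin_nonzero(1) [OF assms] .
  \<comment> \<open>Splitting off first factors, or the last one for (q;q), exposes the parameters
    of \<open>S'\<close>; the factors 1 - t1 t_j collect to \<open>aw_c\<close>.\<close>
  have e: "qpoch q (1 / q ^ Suc m) (Suc m) = (1 - 1 / q ^ Suc m) * X"
    "qpoch q (P * q powi (int (Suc m) - 1)) (Suc m) = (1 - P * q ^ m) * Y"
    "qpoch q q (Suc m) * qpoch q (t1 * t2) (Suc m) * qpoch q (t1 * t3) (Suc m) *
      qpoch q (t1 * t4) (Suc m) = aw_c t1 t2 t3 t4 * (1 - q ^ Suc m) * den"
  proof -
    have "q * (1 / q ^ Suc m) = 1 / q ^ m" "q * (P * q ^ m) = P * q ^ Suc m" "int (Suc m) - 1 = int m"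
      using q0 by simp_all
    then show "qpoch q (1 / q ^ Suc m) (Suc m) = (1 - 1 / q ^ Suc m) * X"
      "qpoch q (P * q powi (int (Suc m) - 1)) (Suc m) = (1 - P * q ^ m) * Y"
      unfolding X_def Y_def by (simp_all only: qpoch_Suc_shift power_int_of_nat)
    show "qpoch q q (Suc m) * qpoch q (t1 * t2) (Suc m) * qpoch q (t1 * t3) (Suc m) *
      qpoch q (t1 * t4) (Suc m) = aw_c t1 t2 t3 t4 * (1 - q ^ Suc m) * den"
      unfolding qpoch_Suc_shift [of q "t1 * t2"] qpoch_Suc_shift [of q "t1 * t3"]
        qpoch_Suc_shift [of q "t1 * t4"] qpoch_Suc [of q q] den_def aw_c_def
      by (simp add: mult_ac)
  qed
  have "aw_c t1 t2 t3 t4 * (\<kappa>' * \<pi> t1 (Suc m)) = (1 - 1 / q ^ Suc m) / (1 - q ^ Suc m) *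
      (- (q ^ Suc m)) * (t1 * (1 - P * q ^ m) * r)"
    using c_nonzero unfolding \<kappa>'_def e lead_const_Suc r_def \<kappa>_def by (simp add: mult_ac)
  also have "(1 - 1 / q ^ Suc m) / (1 - q ^ Suc m) * (- (q ^ Suc m)) = 1"
  proof -
    have "(1 - 1 / u) / (1 - u) * (- u) = 1" if "u \<noteq> 0" "1 - u \<noteq> 0" for u :: real
      using that by (simp add: field_simps)
    then show ?thesis
      using nz q0 by simp
  qed
  finally have "aw_c t1 t2 t3 t4 * (\<kappa>' * \<pi> t1 (Suc m)) = t1 * (1 - P * q ^ m) * r"
    by simp
  with laurent_lead_scaleR [OF 2, of "aw_c t1 t2 t3 t4"] S \<open>r \<noteq> 0\<close> show ?thesis
    by auto
qed

text \<open>Members of different degree are orthogonal by \<open>f_perp\<close> and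
  \<open>g_perp\<close>, since the lower one lies in the smaller space; only the two members of
  equal degree need \<open>fg\<close>.\<close>

lemma orthogonal_basis:
  assumes f: "\<And>n. n \<le> N \<Longrightarrow> f n \<in> laurent_space n"
    and g: "\<And>m. m < N \<Longrightarrow> g (Suc m) \<in> laurent_space (Suc m)"
    and f0: "laurent_lead 0 r r' (f 0)" "r \<noteq> 0"
    and lead: "\<And>m. m < N \<Longrightarrow> \<exists>a b c d. laurent_lead (Suc m) a b (f (Suc m)) \<and>
      laurent_lead (Suc m) c d (g (Suc m)) \<and> a * d \<noteq> b * c"
    and f_perp: "\<And>m v. m < N \<Longrightarrow> v \<in> laurent_space m \<Longrightarrow> form (f (Suc m)) v = 0"
    and g_perp: "\<And>m v. m < N \<Longrightarrow> v \<in> laurent_space m \<Longrightarrow> form (g (Suc m)) v = 0"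
    and fg: "\<And>m. m < N \<Longrightarrow> form (f (Suc m)) (g (Suc m)) = 0"
  shows "racah_orthogonal_basis N q t1 t2 t3 t4 (f ` {0..N} \<union> g ` {1..N})"
proof -
  let ?B = "f ` {0..N} \<union> g ` {1..N}"
  have lead': "\<exists>a b c d. laurent_lead n a b (f n) \<and> laurent_lead n c d (g n) \<and> a * d \<noteq> b * c"
    if "1 \<le> n" "n \<le> N" for n
    using that lead [of "n - 1"] by (cases n) auto
  have g': "g n \<in> laurent_space n" if "1 \<le> n" "n \<le> N" for n
    using that g [of "n - 1"] by (cases n) auto
  have lower: "form x y = 0" if *: "k < n" "n \<le> N" "x = f n \<or> x = g n" "y \<in> laurent_space k" for k n x y
  proof -
    obtain m where m: "n = Suc m"
      using * by (cases n) auto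
    have "y \<in> laurent_space m"
      using * m laurent_space_mono [of k m] by auto
    then show ?thesis
      using * m f_perp g_perp by auto
  qed
  have "form x y = 0" if x: "x \<in> ?B" and y: "y \<in> ?B" and neq: "x \<noteq> y" for x y
  proof -
    obtain n where n: "n \<le> N" "x = f n \<or> x = g n \<and> 1 \<le> n" "x \<in> laurent_space n"
      using x f g' by fastforce
    obtain k where k: "k \<le> N" "y = f k \<or> y = g k \<and> 1 \<le> k" "y \<in> laurent_space k"
      using y f g' by fastforce
    consider "k < n" | "n < k" | "k = n"
      by linarith
    then show ?thesis
    proof cases
      case 1
      then show ?thesis
        using lower [of k n x y] n k by blast
    next
      case 2
      then show ?thesis
        using lower [of n k y x] n k form_commute [of x y] by auto
    next
      case 3
      with n k neq have "n \<noteq> 0" and xy: "x = f n \<and> y = g n \<or> x = g n \<and> y = f n"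
        by auto
      then obtain m where "n = Suc m"
        using not0_implies_Suc by blast
      with xy show ?thesis
        using fg [of m] n(1) form_commute [of x y] by auto
    qed
  qed
  then show ?thesis
    unfolding racah_orthogonal_basis_def pairwise_def
    using laurent_space_basis [OF laurent_space_subset_span, of r r' f N g] f0 lead' f g'
    by blast
qed

text \<open>Equality would annihilate a factor of (q t1 / t3;q)_N, a denominator of the
  form.\<close>

lemma tau_neq_1:
  assumes "m < N"
  shows "t3 * t4 * q ^ m \<noteq> 1"
proof
  assume "t3 * t4 * q ^ m = 1"
  then have 1: "C * q ^ m = A * q ^ N"
    using ABC_nonzero q0 unfolding C_ratio by (simp add: field_simps)
  have "q ^ N = q ^ Suc (N - Suc m) * q ^ m"
  proof -
    have "N = Suc (N - Suc m) + m"
      using assms by simp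
    then show ?thesis
      by (metis power_add)
  qed
  with 1 have "C = A * q ^ Suc (N - Suc m)"
    using q0 by simp
  then have "q * A / C * q ^ (N - Suc m) = 1"
    using ABC_nonzero by (simp add: divide_simps)
  moreover have "N - Suc m < N"
    using assms by simp
  ultimately have "qpoch q (q * A / C) N = 0"
    unfolding qpoch_real_eq_0_iff by blast
  then show False
    using lower_nonzero(2) by simp
qed

lemma basis_RU:
  "racah_orthogonal_basis N q t1 t2 t3 t4 (R ` {0..N} \<union> U ` {1..N})"
proof -
  obtain r where r: "r \<noteq> 0" "laurent_lead 0 r r (R 0)"
    using lead_R [of 0] by auto
  show ?thesis
  proof (rule orthogonal_basis [where r = r and r' = r])
    fix m assume m: "m < N"
    obtain s u where "s \<noteq> 0" "laurent_lead (Suc m) s s (R (Suc m))"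
      "u \<noteq> 0" "laurent_lead (Suc m) (B * u) u (U (Suc m))"
      using lead_R [of "Suc m"] lead_U [OF m] m by auto
    moreover from this have "s * u \<noteq> s * (B * u)"
      using B_neq_1 by simp
    ultimately show "\<exists>a b c d. laurent_lead (Suc m) a b (R (Suc m)) \<and>
      laurent_lead (Suc m) c d (U (Suc m)) \<and> a * d \<noteq> b * c"
      by blast
  next
    show "R n \<in> laurent_space n" if "n \<le> N" for n
      using lead_R [OF that] laurent_lead_space by blast
    show "U (Suc m) \<in> laurent_space (Suc m)" if "m < N" for m
      using lead_U [OF that] laurent_lead_space by blast
  qed (simp_all add: r R_perp U_perp R_perp_U)
qed

lemma basis_TS:
  assumes "t3 * t4 \<noteq> q"
  shows "racah_orthogonal_basis N q t1 t2 t3 t4 (T ` {0..N} \<union> S ` {1..N})"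
proof -
  obtain r where r: "r \<noteq> 0" "laurent_lead 0 r (q ^ 0 * r) (T 0)"
    using lead_T [of 0] by auto
  show ?thesis
  proof (rule orthogonal_basis [where r = r and r' = "q ^ 0 * r"])
    fix m assume m: "m < N"
    obtain s u where "s \<noteq> 0" "laurent_lead (Suc m) s (q ^ Suc m * s) (T (Suc m))"
      "u \<noteq> 0" "laurent_lead (Suc m) u (t3 * t4 * q ^ m * u) (S (Suc m))"
      using lead_T [of "Suc m"] lead_S_R [OF m] m by auto
    moreover from this have "s * (t3 * t4 * q ^ m * u) \<noteq> q ^ Suc m * s * u"
      using assms q0 by simp
    ultimately show "\<exists>a b c d. laurent_lead (Suc m) a b (T (Suc m)) \<and>
      laurent_lead (Suc m) c d (S (Suc m)) \<and> a * d \<noteq> b * c"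
      by blast
  next
    show "T n \<in> laurent_space n" if "n \<le> N" for n
      using lead_T [OF that] laurent_lead_space by blast
    show "S (Suc m) \<in> laurent_space (Suc m)" if "m < N" for m
      using lead_S_R [OF that] laurent_lead_space by blast
    show "laurent_lead 0 r (q ^ 0 * r) (T 0)"
      by (rule r)
  qed (simp_all add: r T_perp [OF assms] S_perp T_perp_S)
qed

text \<open>With n = m + 1, a combination of S_n and c R_n, corrected by a multiple of an element
  orthogonal to R_n (for the second claim, to S_n), has vanishing outer coefficients and so lies in
  V_(n-1). Pairing it with R_n, respectively S_n, gives the relation.\<close>

lemma form_ratios:
  assumes "m < N"
  defines "\<tau> \<equiv> t3 * t4 * q ^ m" and "b \<equiv> t1 * (1 - P * q ^ m)"
  shows "c * form (R (Suc m)) (R (Suc m)) = t1 * (1 - B) * form (R (Suc m)) (S (Suc m))"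
    and "(\<tau> - q ^ Suc m) * c * form (R (Suc m)) (S (Suc m))
      = b * (1 - q ^ Suc m) * form (S (Suc m)) (S (Suc m))"
proof -
  obtain r where r: "r \<noteq> 0" "laurent_lead (Suc m) r (\<tau> * r) (S (Suc m))"
    "laurent_lead (Suc m) (b * r) (b * r) (c *\<^sub>R R (Suc m))"
    using lead_S_R [OF assms(1)] unfolding \<tau>_def b_def by blast
  have b: "b = t1 * (1 - B * \<tau>)"
    by (simp add: b_def \<tau>_def B_def)
  define \<eta> where "\<eta> = q ^ m * \<pi> t1 m"
  have \<eta>: "\<eta> \<noteq> 0"
    using q0 \<pi>_nonzero by (simp add: \<eta>_def)
  have H: "laurent_lead (Suc m) (B * \<eta>) \<eta> (hL * e2 m)"
    unfolding \<eta>_def by (rule lead_hL [OF lead_e2])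
  \<comment> \<open>Chosen to cancel the coefficient of z^-(m+1); the shape of \<open>b\<close>
    makes that of z^(m+1) cancel as well.\<close>
  define k where "k = r * (t1 * (1 - B) * \<tau> - b) / \<eta>"
  have k: "k * \<eta> = r * (t1 * (1 - B) * \<tau> - b)"
    using \<eta> by (simp add: k_def)
  have z: "t1 * (1 - B) * r - b * r - k * (B * \<eta>) = 0" "t1 * (1 - B) * (\<tau> * r) - b * r - k * \<eta> = 0"
    using k unfolding b by algebra+
  have "(t1 * (1 - B)) *\<^sub>R S (Suc m) - c *\<^sub>R R (Suc m) - k *\<^sub>R (hL * e2 m) \<in> laurent_space m"
    using laurent_lead_diff [OF laurent_lead_diff [OF laurent_lead_scaleR [OF r(2), of "t1 * (1 - B)"] r(3)]
      laurent_lead_scaleR [OF H, of k]]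
    unfolding z by (rule laurent_lead_0_0)
  from R_perp [OF assms(1) this]
  show "c * form (R (Suc m)) (R (Suc m)) = t1 * (1 - B) * form (R (Suc m)) (S (Suc m))"
    by (simp add: form_diff_right form_scaleR_right R_perp_hL_e2)
  define \<theta> where "\<theta> = \<pi> t1 (Suc m)"
  have \<theta>: "\<theta> \<noteq> 0"
    using \<pi>_nonzero by (simp add: \<theta>_def)
  have E: "laurent_lead (Suc m) \<theta> (q ^ Suc m * \<theta>) (e1 (Suc m))"
    unfolding \<theta>_def by (rule lead_e1)
  define u where "u = q ^ Suc m"
  \<comment> \<open>Chosen to cancel the coefficient of z^(m+1); the multipliers \<tau> - u and b (1
    - u) are such that the opposite one cancels too.\<close>
  define l where "l = b * r * (\<tau> - 1) / \<theta>"
  have l: "l * \<theta> = b * r * (\<tau> - 1)"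
    using \<theta> by (simp add: l_def)
  have z: "(\<tau> - u) * (b * r) - b * (1 - u) * r - l * \<theta> = 0"
    "(\<tau> - u) * (b * r) - b * (1 - u) * (\<tau> * r) - l * (u * \<theta>) = 0"
    using l by algebra+
  have "(\<tau> - u) *\<^sub>R (c *\<^sub>R R (Suc m)) - (b * (1 - u)) *\<^sub>R S (Suc m) - l *\<^sub>R e1 (Suc m) \<in> laurent_space m"
    using laurent_lead_diff [OF laurent_lead_diff [OF laurent_lead_scaleR [OF r(3), of "\<tau> - u"]
      laurent_lead_scaleR [OF r(2), of "b * (1 - u)"]] laurent_lead_scaleR [OF E [folded u_def], of l]]
    unfolding z by (rule laurent_lead_0_0)
  from S_perp [OF assms(1) this]
  show "(\<tau> - q ^ Suc m) * c * form (R (Suc m)) (S (Suc m))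
      = b * (1 - q ^ Suc m) * form (S (Suc m)) (S (Suc m))"
    unfolding u_def [symmetric]
    by (simp add: form_diff_right form_scaleR_right S_perp_e1 form_commute [of "S (Suc m)" "R (Suc m)"])
qed

text \<open>The determinant of the outer coefficients is that of the combination matrix times b r^2
  (\<tau> - 1), the determinant for c R_n and S_n, which is nonzero.\<close>

lemma basis_combination:
  fixes f g :: "nat \<Rightarrow> laurent"
  assumes f0: "f 0 = k0 *\<^sub>R R 0" "k0 \<noteq> 0"
    and f: "\<And>m. m < N \<Longrightarrow> f (Suc m) = (x m * c) *\<^sub>R R (Suc m) + y m *\<^sub>R S (Suc m)"
    and g: "\<And>m. m < N \<Longrightarrow> g (Suc m) = (x' m * c) *\<^sub>R R (Suc m) + y' m *\<^sub>R S (Suc m)"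
    and det: "\<And>m. m < N \<Longrightarrow> x m * y' m \<noteq> x' m * y m"
    and orth: "\<And>m. m < N \<Longrightarrow> form (f (Suc m)) (g (Suc m)) = 0"
  shows "racah_orthogonal_basis N q t1 t2 t3 t4 (f ` {0..N} \<union> g ` {1..N})"
proof -
  obtain r0 where r0: "r0 \<noteq> 0" "laurent_lead 0 r0 r0 (R 0)"
    using lead_R [of 0] by auto
  have 0: "laurent_lead 0 (k0 * r0) (k0 * r0) (f 0)" "k0 * r0 \<noteq> 0"
    unfolding f0 using r0 f0 by (auto intro: laurent_lead_scaleR)
  have lead: "\<exists>p p' s s'. laurent_lead (Suc m) p p' (f (Suc m)) \<and>
      laurent_lead (Suc m) s s' (g (Suc m)) \<and> p * s' \<noteq> p' * s" if m: "m < N" for m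
  proof -
    define \<tau> b where "\<tau> = t3 * t4 * q ^ m" and "b = t1 * (1 - P * q ^ m)"
    obtain r where r: "r \<noteq> 0" "laurent_lead (Suc m) r (\<tau> * r) (S (Suc m))"
      "laurent_lead (Suc m) (b * r) (b * r) (c *\<^sub>R R (Suc m))"
      using lead_S_R [OF m] unfolding \<tau>_def b_def by blast
    have comb: "laurent_lead (Suc m) (s * (b * r) + s' * r) (s * (b * r) + s' * (\<tau> * r))
        ((s * c) *\<^sub>R R (Suc m) + s' *\<^sub>R S (Suc m))" for s s'
      using laurent_lead_add [OF laurent_lead_scaleR [OF r(3)] laurent_lead_scaleR [OF r(2)], of s s']
      by simp
    have "b \<noteq> 0"
      using P_neq_1 [OF m] t_nonzero by (simp add: b_def)
    moreover have "\<tau> - 1 \<noteq> 0"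
      using tau_neq_1 [OF m] by (simp add: \<tau>_def)
    ultimately have "(x m * y' m - x' m * y m) * (b * r * r * (\<tau> - 1)) \<noteq> 0"
      using det [OF m] r(1) by simp
    also have "(x m * y' m - x' m * y m) * (b * r * r * (\<tau> - 1)) =
      (x m * (b * r) + y m * r) * (x' m * (b * r) + y' m * (\<tau> * r)) -
      (x m * (b * r) + y m * (\<tau> * r)) * (x' m * (b * r) + y' m * r)"
      by algebra
    finally show ?thesis
      using comb [of "x m" "y m"] comb [of "x' m" "y' m"] unfolding f [OF m] g [OF m]
      by (metis eq_iff_diff_eq_0)
  qed
  show ?thesis
  proof (rule orthogonal_basis [OF _ _ 0 lead])
    show "f n \<in> laurent_space n" if "n \<le> N" for n
    proof (cases n)
      case (Suc m)
      with that show ?thesis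
        using lead [of m] by (auto dest: laurent_lead_space)
    qed (use 0 laurent_lead_space in auto)
    show "g (Suc m) \<in> laurent_space (Suc m)" if "m < N" for m
      using lead [OF that] by (auto dest: laurent_lead_space)
    show "form (f (Suc m)) (g (Suc m)) = 0" if "m < N" for m
      by (rule orth [OF that])
  qed (auto simp: f g form_add_left form_scaleR_left R_perp S_perp)
qed

text \<open>The product \<open>c * form (R n) (R n)\<close> is kept together so that the first claim
  of \<open>form_ratios\<close> can rewrite it.\<close>

lemma form_combination:
  "form ((x * c) *\<^sub>R R n + y *\<^sub>R S n) ((x' * c) *\<^sub>R R n + y' *\<^sub>R S n) =
     x * x' * c * (c * form (R n) (R n)) + (x * y' + x' * y) * c * form (R n) (S n)
     + y * y' * form (S n) (S n)"
  by (simp add: form_add_left form_add_right form_scaleR_left form_scaleR_right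
      form_commute [of "S n" "R n"] algebra_simps)

text \<open>Brings a family indexed by -N, ..., N into the two-part shape of
  \<open>basis_combination\<close>.\<close>

lemma index_image:
  "F ` {- int N..int N} = (\<lambda>n. F (int n)) ` {0..N} \<union> (\<lambda>n. F (- int n)) ` {1..N}"
proof -
  have "k \<in> int ` {0..N} \<union> (\<lambda>n. - int n) ` {1..N}" if "k \<in> {- int N..int N}" for k
  proof (cases "0 \<le> k")
    case True
    with that show ?thesis
      by (intro UnI1 image_eqI [of _ _ "nat k"]) auto
  next
    case False
    with that show ?thesis
      by (intro UnI2 image_eqI [of _ _ "nat (- k)"]) auto
  qed
  then have "{- int N..int N} \<subseteq> int ` {0..N} \<union> (\<lambda>n. - int n) ` {1..N}"
    by blast
  then have "{- int N..int N} = int ` {0..N} \<union> (\<lambda>n. - int n) ` {1..N}"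
    by (intro equalityI) auto
  then show ?thesis
    by (simp add: image_Un image_image)
qed

text \<open>The determinant of the coefficients of X_n and X_-n is -t1 times the expression in the
  hypothesis.\<close>

lemma basis_X:
  assumes "\<forall>n\<in>{1..N}. t1 * t2 * (1 - q ^ n) + (1 - P * q ^ (n - 1)) \<noteq> 0"
  shows "racah_orthogonal_basis N q t1 t2 t3 t4 (aw_X q t1 t2 t3 t4 ` {- int N..int N})"
  unfolding index_image
proof (rule basis_combination)
  show "aw_X q t1 t2 t3 t4 (int 0) = c *\<^sub>R R 0"
    by (simp add: aw_X_def)
  show "c \<noteq> 0"
    by (rule c_nonzero)
next
  fix m assume m: "m < N"
  have X: "aw_X q t1 t2 t3 t4 (int (Suc m)) = (1 * c) *\<^sub>R R (Suc m) +
      (t1\<^sup>2 * t2 * (1 - q ^ Suc m)) *\<^sub>R S (Suc m)"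
    unfolding aw_X_def Let_def by (simp add: nat_add_distrib)
  have X': "aw_X q t1 t2 t3 t4 (- int (Suc m)) = (1 * c) *\<^sub>R R (Suc m) +
      (- (t1 * (1 - P * q ^ m))) *\<^sub>R S (Suc m)"
    unfolding aw_X_def Let_def by (simp add: nat_add_distrib)
  show "aw_X q t1 t2 t3 t4 (int (Suc m)) = (1 * c) *\<^sub>R R (Suc m) +
      (t1\<^sup>2 * t2 * (1 - q ^ Suc m)) *\<^sub>R S (Suc m)"
    by (rule X)
  show "aw_X q t1 t2 t3 t4 (- int (Suc m)) = (1 * c) *\<^sub>R R (Suc m) +
      (- (t1 * (1 - P * q ^ m))) *\<^sub>R S (Suc m)"
    by (rule X')
  have "t1 * t2 * (1 - q ^ Suc m) + (1 - P * q ^ m) \<noteq> 0"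
    using assms m by (auto dest: bspec [of _ _ "Suc m"])
  then have "t1 * (t1 * t2 * (1 - q ^ Suc m) + (1 - P * q ^ m)) \<noteq> 0"
    using t_nonzero by simp
  then show "1 * - (t1 * (1 - P * q ^ m)) \<noteq> 1 * (t1\<^sup>2 * t2 * (1 - q ^ Suc m))"
    by (simp add: algebra_simps power2_eq_square)
  define u where "u = q ^ Suc m"
  define \<tau> where "\<tau> = t3 * t4 * q ^ m"
  have P: "P * q ^ m = B * \<tau>"
    by (simp add: B_def \<tau>_def)
  note 1 = form_ratios [OF m, folded \<tau>_def u_def, unfolded P]
  \<comment> \<open>With the first ratio substituted, the product is t1 B times the difference of
    the two sides of the second relation.\<close>
  show "form (aw_X q t1 t2 t3 t4 (int (Suc m))) (aw_X q t1 t2 t3 t4 (- int (Suc m))) = 0"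
    using 1(2) unfolding X X' form_combination 1(1) P u_def [symmetric]
    unfolding B_def by algebra
qed

text \<open>Here the determinant is -t1 q^(n-1) times the expression in the hypothesis, and the
  product is t1 times the difference of the two sides of the second relation in
  \<open>form_ratios\<close>.\<close>

lemma basis_Y:
  assumes "\<forall>n\<in>{1..N}. t3 * t4 * (1 - q ^ n) + q * (1 - P * q ^ (n - 1)) \<noteq> 0"
  shows "racah_orthogonal_basis N q t1 t2 t3 t4 (aw_Y q t1 t2 t3 t4 ` {- int N..int N})"
  unfolding index_image
proof (rule basis_combination)
  show "aw_Y q t1 t2 t3 t4 (int 0) = c *\<^sub>R R 0"
    by (simp add: aw_Y_def)
  show "c \<noteq> 0"
    by (rule c_nonzero)
next
  fix m assume m: "m < N"
  have Y: "aw_Y q t1 t2 t3 t4 (int (Suc m)) = (q ^ Suc m * c) *\<^sub>R R (Suc m) +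
      (t1 * (1 - q ^ Suc m)) *\<^sub>R S (Suc m)"
    unfolding aw_Y_def Let_def by (simp add: nat_add_distrib)
  have Y': "aw_Y q t1 t2 t3 t4 (- int (Suc m)) = (t3 * t4 * q ^ m * c) *\<^sub>R R (Suc m) +
      (- (t1 * (1 - P * q ^ m))) *\<^sub>R S (Suc m)"
    unfolding aw_Y_def Let_def by (simp add: nat_add_distrib mult_ac)
  show "aw_Y q t1 t2 t3 t4 (int (Suc m)) = (q ^ Suc m * c) *\<^sub>R R (Suc m) +
      (t1 * (1 - q ^ Suc m)) *\<^sub>R S (Suc m)"
    by (rule Y)
  show "aw_Y q t1 t2 t3 t4 (- int (Suc m)) = (t3 * t4 * q ^ m * c) *\<^sub>R R (Suc m) +
      (- (t1 * (1 - P * q ^ m))) *\<^sub>R S (Suc m)"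
    by (rule Y')
  have "t3 * t4 * (1 - q ^ Suc m) + q * (1 - P * q ^ m) \<noteq> 0"
    using assms m by (auto dest: bspec [of _ _ "Suc m"])
  then have "t1 * q ^ m * (t3 * t4 * (1 - q ^ Suc m) + q * (1 - P * q ^ m)) \<noteq> 0"
    using t_nonzero q0 by simp
  then show "q ^ Suc m * - (t1 * (1 - P * q ^ m)) \<noteq> t3 * t4 * q ^ m * (t1 * (1 - q ^ Suc m))"
    by (simp add: algebra_simps)
  define u where "u = q ^ Suc m"
  define \<tau> where "\<tau> = t3 * t4 * q ^ m"
  have P: "P * q ^ m = B * \<tau>"
    by (simp add: B_def \<tau>_def)
  note 1 = form_ratios [OF m, folded \<tau>_def u_def, unfolded P]
  show "form (aw_Y q t1 t2 t3 t4 (int (Suc m))) (aw_Y q t1 t2 t3 t4 (- int (Suc m))) = 0"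
    using 1(2) unfolding Y Y' form_combination 1(1) P u_def [symmetric] \<tau>_def [symmetric]
    by algebra
qed

end

section \<open>Symmetry of the families and of the form in t3 and t4\<close>

lemma phi43_swap: "phi43 q a1 a2 a3 a4 b1 b2 b3 = phi43 q a1 a2 a3 a4 b1 b3 b2"
  unfolding phi43_def by (simp only: mult_ac)

lemma aw_R_swap: "aw_R q t1 t2 t4 t3 = aw_R q t1 t2 t3 t4"
  unfolding aw_R_def phi43_swap [of _ _ _ _ _ _ "t1 * t4" "t1 * t3"] by (simp only: mult_ac)

lemma aw_S_swap: "aw_S q t1 t2 t4 t3 = aw_S q t1 t2 t3 t4"
  unfolding aw_S_def phi43_swap [of _ _ _ _ _ _ "q * t1 * t4" "q * t1 * t3"] by (simp only: mult_ac)

lemma aw_T_swap: "aw_T q t1 t2 t4 t3 = aw_T q t1 t2 t3 t4"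
  unfolding aw_T_def phi43_swap [of _ _ _ _ _ _ "t1 * t4" "t1 * t3"] by (simp only: mult_ac)

lemma aw_U_swap: "aw_U q t1 t2 t4 t3 = aw_U q t1 t2 t3 t4"
  unfolding aw_U_def aw_R_swap [of q _ _ t4 t3] ..

lemma aw_X_swap: "aw_X q t1 t2 t4 t3 = aw_X q t1 t2 t3 t4"
  unfolding aw_X_def aw_R_swap [of q t1 t2 t4 t3] aw_S_swap [of q t1 t2 t4 t3] aw_c_def by (simp only: mult_ac)

lemma aw_Y_swap: "aw_Y q t1 t2 t4 t3 = aw_Y q t1 t2 t3 t4"
  unfolding aw_Y_def aw_R_swap [of q t1 t2 t4 t3] aw_S_swap [of q t1 t2 t4 t3] aw_c_def by (simp only: mult_ac)

lemma racah_orthogonal_basis_swap: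
  "racah_orthogonal_basis N q t1 t2 t4 t3 = racah_orthogonal_basis N q t1 t2 t3 t4"
  unfolding racah_orthogonal_basis_def racah_form_def by (simp only: mult_ac)

lemma racah_well_defined_swap:
  "racah_well_defined N q t1 t2 t4 t3 = racah_well_defined N q t1 t2 t3 t4"
  unfolding racah_well_defined_def by auto

text \<open>The premises on T and S, on X and on Y say that the two members of each degree n \<ge> 1
  have independent outer coefficients; when one fails, such a pair is linearly dependent modulo
  V_(n-1). For R and U this independence follows from t1 t2 being different from 1.\<close>

theorem theorem10p2:
  fixes q t1 t2 t3 t4 :: real and N :: nat
  assumes "0 < q" and "q < 1" and "N \<ge> 1"
    and truncation: "t1 * t3 = q powi (- int N) \<or> t1 * t4 = q powi (- int N)"
    and well_defined: "racah_well_defined N q t1 t2 t3 t4"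
    and nondegenerate: "\<forall>m \<le> 2 * N - 2. t1 * t2 * t3 * t4 * q ^ m \<noteq> 1"
  shows
    "racah_orthogonal_basis N q t1 t2 t3 t4
       (aw_R q t1 t2 t3 t4 ` {0..N} \<union> aw_U q t1 t2 t3 t4 ` {1..N})
     \<and> (t3 * t4 \<noteq> q \<longrightarrow>
        racah_orthogonal_basis N q t1 t2 t3 t4
          (aw_T q t1 t2 t3 t4 ` {0..N} \<union> aw_S q t1 t2 t3 t4 ` {1..N}))
     \<and> ((\<forall>n\<in>{1..N}. t1 * t2 * (1 - q ^ n) + (1 - t1 * t2 * t3 * t4 * q ^ (n - 1)) \<noteq> 0) \<longrightarrow>
        racah_orthogonal_basis N q t1 t2 t3 t4 (aw_X q t1 t2 t3 t4 ` {- int N..int N}))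
     \<and> ((\<forall>n\<in>{1..N}. t3 * t4 * (1 - q ^ n) + q * (1 - t1 * t2 * t3 * t4 * q ^ (n - 1)) \<noteq> 0) \<longrightarrow>
        racah_orthogonal_basis N q t1 t2 t3 t4 (aw_Y q t1 t2 t3 t4 ` {- int N..int N}))"
proof -
  have powi: "q powi (- int N) = 1 / q ^ N"
    by (simp add: power_int_minus divide_inverse)
  from truncation show ?thesis
  proof
    assume "t1 * t4 = q powi (- int N)"
    then interpret racah_setup q t1 t2 t3 t4 N
      using assms by unfold_locales (auto simp: powi)
    show ?thesis
      using basis_RU basis_TS basis_X basis_Y by blast
  next
    assume "t1 * t3 = q powi (- int N)"
    moreover have P: "t1 * t2 * t4 * t3 = t1 * t2 * t3 * t4"
      by simp
    \<comment> \<open>Exchanging t3 and t4 turns this case into j = 4; the swap lemmas translate the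
      result back.\<close>
    ultimately interpret racah_setup q t1 t2 t4 t3 N
      using assms by unfold_locales (auto simp: powi racah_well_defined_swap P)
    show ?thesis
      using basis_RU basis_TS basis_X basis_Y
      unfolding P mult.commute [of t4 t3] aw_R_swap [of q t1 t2 t4 t3] aw_S_swap [of q t1 t2 t4 t3] aw_T_swap [of q t1 t2 t4 t3] aw_U_swap [of q t1 t2 t4 t3]
        aw_X_swap [of q t1 t2 t4 t3] aw_Y_swap [of q t1 t2 t4 t3] racah_orthogonal_basis_swap [of N q t1 t2 t4 t3] by blast
  qed
qed

end
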